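(* Let $\chi\ge 2$ be a constant integer. Consider recursive Path ORAM for $N$ data blocks with non-uniform block sizes: the data ORAM $\mathsf{ORam}_0$ uses blocks (regular blocks) of $B=\Omega(\log^2 N)$ bits, and the position-map ORAMs $\mathsf{ORam}_i$, $i\ge1$, use small blocks of $\chi\lceil\log_2 N\rceil$ bits. Then each load/store operation on a data block involves communication of $O(\log^2 N)$ small blocks and $O(\log N)$ regular blocks, hence has bandwidth cost $O(\log N)$ regular blocks. Moreover, for every function $h(N)=\omega(1)$, client storage of $O(\log^2 N\cdot h(N))$ small blocks and $O(\log N\cdot h(N))$ regular blocks, hence in total $O(\log N\cdot h(N))$ regular blocks, suffices for the following: for any sequence of $\mathrm{poly}(N)$ load/store operations on the $N$ data blocks, the probability that the client storage is exceeded at the end of some operation is at most $N^{-\omega(1)}$.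
   Context: Non-recursive Path ORAM. There is a complete binary tree of height $L$, stored on a server, with levels $0$ (root) to $L$ (leaves) and leaves labelled $0,\dots,2^L-1$. Each node is a bucket holding at most $Z$ real blocks, padded with dummy blocks to exactly $Z$ blocks. $\mathcal P(x)$ is the set of buckets on the path from leaf $x$ to the root, and $\mathcal P(x,\ell)$ is its bucket at level $\ell$. The client keeps a stash $S$ (a set of blocks), and a position map gives each block address $a$ a leaf label. Initially the buckets and stash contain no real blocks and the labels are independent uniform. To access (read or write) block $a$ with current label $x$: (1) replace the label of $a$ by a fresh independent uniform label; (2) read all buckets of $\mathcal P(x)$ from the server, moving their real blocks into $S$ (if $a$ was never accessed before, block $a$ is created in $S$), and read or update block $a$; (3) for $\ell=L,L-1,\dots,0$, let $S'$ be the set of blocks in $S$ whose current label $x'$ satisfies $\mathcal P(x',\ell)=\mathcal P(x,\ell)$, move $\min(|S'|,Z)$ of them from $S$ into bucket $\mathcal P(x,\ell)$, pad with dummies and write the bucket to the server. Here $Z=5$, and an ORAM for $n$ blocks uses $L=\lceil\log_2 n\rceil$. The bandwidth of an access is the number of blocks (real or dummy) read from or written to the server. Recursive Path ORAM consists of non-recursive Path ORAMs $\mathsf{ORam}_0,\dots,\mathsf{ORam}_X$. $\mathsf{ORam}_0$ holds the $N_0=N$ data blocks. The position map of $\mathsf{ORam}_i$ is not kept by the client but is stored in the blocks of $\mathsf{ORam}_{i+1}$: a block of $\chi\lceil\log_2 N\rceil$ bits stores $\chi$ labels, so $\mathsf{ORam}_{i+1}$ holds $N_{i+1}=\lceil N_i/\chi\rceil$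 blocks and the label of block $a$ of $\mathsf{ORam}_i$ is in block $\lfloor a/\chi\rfloor$ of $\mathsf{ORam}_{i+1}$. The recursion stops at the first $X$ with $N_X\le\chi$, and the client stores the position map of $\mathsf{ORam}_X$. A load/store operation on a data block accesses one block in each of $\mathsf{ORam}_X,\dots,\mathsf{ORam}_0$: the access to $\mathsf{ORam}_{i+1}$ retrieves the needed label for $\mathsf{ORam}_i$ and overwrites it by the fresh label. The randomness of different levels is independent. Client storage consists of the stashes of all levels (each with a prescribed capacity; failure means that a stash contains more blocks than its capacity at the end of an operation) and the position map of $\mathsf{ORam}_X$. The sequence of data-block addresses is arbitrary but fixed independently of the random labels. Asymptotics are as $N\to\infty$. *)

theory Defs
  imports "HOL-Probability.Probability" "HOL-Library.Landau_Symbols" "HOL-Library.Multiset"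
begin

section \<open>Non-recursive Path ORAM\<close>

definition bucket_size :: nat where
  "bucket_size = 5"

definition height :: "nat \<Rightarrow> nat" where
  "height n = nat \<lceil>log 2 (real n)\<rceil>"

text \<open>
  Regular blocks hold arbitrary data; small blocks hold the leaf labels of blocks of the
  next ORAM. Every block is kept together with its address and its current label: the client
  needs the labels of all blocks in its stash to evict them, and in the recursive construction
  the position map is not at hand. Only an access to a block changes its label, and at that
  moment the block is in the stash.
\<close>

datatype 'v content = Data 'v | Labels (labels: "nat list")

datatype 'v block = Block (addr: nat) (label: nat) (content: "'v content")

text \<open>Dummy blocks are represented by \<^const>\<open>None\<close>.\<close>

type_synonym 'v bucket = "'v block option multiset"

text \<open>A node of the tree is a pair of its level and its index (from the left) in that level.\<close>

record 'v oram =
  tree :: "nat \<times> nat \<Rightarrow> 'v bucket"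
  stash :: "'v block set"

definition real_blocks :: "'v bucket \<Rightarrow> 'v block set" where
  "real_blocks K = {b. Some b \<in># K}"

definition padded :: "'v block set \<Rightarrow> 'v bucket" where
  "padded M = image_mset Some (mset_set M) + replicate_mset (bucket_size - card M) None"

definition empty_oram :: "'v oram" where
  "empty_oram = \<lparr>tree = (\<lambda>_. padded {}), stash = {}\<rparr>"

definition path_node :: "nat \<Rightarrow> nat \<Rightarrow> nat \<Rightarrow> nat \<times> nat" where
  "path_node L x l = (l, x div 2 ^ (L - l))"

definition path_nodes :: "nat \<Rightarrow> nat \<Rightarrow> (nat \<times> nat) list" where
  "path_nodes L x = map (path_node L x) [0..<Suc L]"

text \<open>
  The algorithm leaves open which of the eligible blocks are moved into a bucket. A policy
  resolves this choice, given the index of the ORAM within the recursion, its current state,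
  the accessed leaf, the level of the bucket, and the set of eligible blocks.
\<close>

type_synonym 'v policy =
  "nat \<Rightarrow> 'v oram \<Rightarrow> nat \<Rightarrow> nat \<Rightarrow> 'v block set \<Rightarrow> 'v block set"

definition valid_policy :: "'v policy \<Rightarrow> bool" where
  "valid_policy pick \<longleftrightarrow> (\<forall>i R x l E. finite E \<longrightarrow>
     pick i R x l E \<subseteq> E \<and> card (pick i R x l E) = min (card E) bucket_size)"

definition evict :: "'v policy \<Rightarrow> nat \<Rightarrow> nat \<Rightarrow> nat \<Rightarrow> nat \<Rightarrow> 'v oram \<Rightarrow> 'v oram" where
  "evict pick i L x l R =
     (let E = {b \<in> stash R. path_node L (label b) l = path_node L x l};
          M = pick i R x l E
      in R\<lparr>tree := (tree R)(path_node L x l := padded M), stash := stash R - M\<rparr>)"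

text \<open>
  \<open>access pick i L c0 a x x' f R\<close> accesses block \<open>a\<close>, whose label is \<open>x\<close>,
  gives it the new label \<open>x'\<close> and applies \<open>f\<close> to its content; the content is \<open>c0\<close>
  if the block does not exist yet. The result consists of the content before the update, the
  new state, and the buckets read from and written to the server. The old buckets on the path
  remain in \<^const>\<open>tree\<close> until they are overwritten, which happens to all of them.
\<close>

definition access ::
  "'v policy \<Rightarrow> nat \<Rightarrow> nat \<Rightarrow> 'v content \<Rightarrow> nat \<Rightarrow> nat \<Rightarrow> nat \<Rightarrow> ('v content \<Rightarrow> 'v content)
    \<Rightarrow> 'v oram \<Rightarrow> 'v content \<times> 'v oram \<times> 'v bucket list" where
  "access pick i L c0 a x x' f R =
     (let inp = map (tree R) (path_nodes L x);
          S = stash R \<union> (\<Union>K\<in>set inp. real_blocks K);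
          c = (if \<exists>b\<in>S. addr b = a then content (THE b. b \<in> S \<and> addr b = a) else c0);
          S' = insert (Block a x' (f c)) {b \<in> S. addr b \<noteq> a};
          R' = fold (evict pick i L x) (rev [0..<Suc L]) (R\<lparr>stash := S'\<rparr>);
          out = map (tree R') (path_nodes L x)
      in (c, R', inp @ out))"

section \<open>Recursive Path ORAM\<close>

fun num_blocks :: "nat \<Rightarrow> nat \<Rightarrow> nat \<Rightarrow> nat" where
  "num_blocks chi N 0 = N"
| "num_blocks chi N (Suc i) = nat \<lceil>real (num_blocks chi N i) / real chi\<rceil>"

definition top_oram :: "nat \<Rightarrow> nat \<Rightarrow> nat" where
  "top_oram chi N = (LEAST i. num_blocks chi N i \<le> chi)"

definition oram_height :: "nat \<Rightarrow> nat \<Rightarrow> nat \<Rightarrow> nat" where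
  "oram_height chi N i = height (num_blocks chi N i)"

record 'v rec_oram =
  oram :: "nat \<Rightarrow> 'v oram"
  client_map :: "nat \<Rightarrow> nat"  \<comment> \<open>the position map of the last ORAM of the recursion\<close>

datatype 'v operation = Load nat | Store nat 'v

fun op_addr :: "'v operation \<Rightarrow> nat" where
  "op_addr (Load a) = a"
| "op_addr (Store a v) = a"

fun op_update :: "'v operation \<Rightarrow> 'v content \<Rightarrow> 'v content" where
  "op_update (Load a) c = c"
| "op_update (Store a v) c = Data v"

text \<open>
  \<open>ini i a\<close> is the initial label of block \<open>a\<close> of ORAM \<open>i\<close>, and \<open>d0 a\<close> is the initial data of
  data block \<open>a\<close>. A position-map block contains the initial labels when it is created.
\<close>

fun initial_content ::
  "nat \<Rightarrow> (nat \<Rightarrow> 'v) \<Rightarrow> (nat \<times> nat \<Rightarrow> nat) \<Rightarrow> nat \<Rightarrow> nat \<Rightarrow> 'v content" where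
  "initial_content chi d0 ini 0 a = Data (d0 a)"
| "initial_content chi d0 ini (Suc i) a = Labels (map (\<lambda>j. ini (i, a * chi + j)) [0..<chi])"

definition initial_state :: "nat \<Rightarrow> nat \<Rightarrow> (nat \<times> nat \<Rightarrow> nat) \<Rightarrow> 'v rec_oram" where
  "initial_state chi N ini =
     \<lparr>oram = (\<lambda>_. empty_oram), client_map = (\<lambda>a. ini (top_oram chi N, a))\<rparr>"

text \<open>The buckets transferred by one operation, for each ORAM of the recursion.\<close>

type_synonym 'v transfer = "nat \<Rightarrow> 'v bucket list"

text \<open>
  \<open>access_from \<dots> i x R\<close> accesses the ORAMs \<open>i, i - 1, \<dots>, 0\<close> in this order. Here \<open>x\<close> is the
  current label of the block to be accessed in ORAM \<open>i\<close>, whose address is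
  \<open>op_addr opn div chi ^ i\<close>, and \<open>fresh j\<close> is the fresh label drawn for ORAM \<open>j\<close>.
\<close>

fun access_from ::
  "nat \<Rightarrow> nat \<Rightarrow> 'v policy \<Rightarrow> (nat \<Rightarrow> 'v) \<Rightarrow> (nat \<times> nat \<Rightarrow> nat) \<Rightarrow> 'v operation \<Rightarrow> (nat \<Rightarrow> nat)
    \<Rightarrow> nat \<Rightarrow> nat \<Rightarrow> (nat \<Rightarrow> 'v oram) \<Rightarrow> (nat \<Rightarrow> 'v oram) \<times> 'v transfer" where
  "access_from chi N pick d0 ini opn fresh 0 x Rs =
     (let a = op_addr opn;
          (_, R', T) = access pick 0 (oram_height chi N 0) (initial_content chi d0 ini 0 a)
                         a x (fresh 0) (op_update opn) (Rs 0)
      in (Rs(0 := R'), (\<lambda>_. [])(0 := T)))"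
| "access_from chi N pick d0 ini opn fresh (Suc i) x Rs =
     (let a = op_addr opn div chi ^ Suc i;
          slot = (op_addr opn div chi ^ i) mod chi;
          (c, R', T) = access pick (Suc i) (oram_height chi N (Suc i))
                         (initial_content chi d0 ini (Suc i) a) a x (fresh (Suc i))
                         (\<lambda>c. Labels ((labels c)[slot := fresh i])) (Rs (Suc i));
          (Rs', Ts) = access_from chi N pick d0 ini opn fresh i (labels c ! slot)
                         (Rs(Suc i := R'))
      in (Rs', Ts(Suc i := T)))"

definition perform ::
  "nat \<Rightarrow> nat \<Rightarrow> 'v policy \<Rightarrow> (nat \<Rightarrow> 'v) \<Rightarrow> (nat \<times> nat \<Rightarrow> nat) \<Rightarrow> 'v operation \<Rightarrow> (nat \<Rightarrow> nat)
    \<Rightarrow> 'v rec_oram \<Rightarrow> 'v rec_oram \<times> 'v transfer" where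
  "perform chi N pick d0 ini opn fresh s =
     (let X = top_oram chi N;
          a = op_addr opn div chi ^ X;
          (Rs, Ts) = access_from chi N pick d0 ini opn fresh X (client_map s a) (oram s)
      in (\<lparr>oram = Rs, client_map = (client_map s)(a := fresh X)\<rparr>, Ts))"

definition random_label :: "nat \<Rightarrow> nat \<Rightarrow> nat \<Rightarrow> nat pmf" where
  "random_label chi N i = pmf_of_set {..<2 ^ oram_height chi N i}"

definition initial_labels :: "nat \<Rightarrow> nat \<Rightarrow> (nat \<times> nat \<Rightarrow> nat) pmf" where
  "initial_labels chi N =
     Pi_pmf (SIGMA i:{..top_oram chi N}. {..<num_blocks chi N i}) 0 (\<lambda>(i, a). random_label chi N i)"

definition fresh_labels :: "nat \<Rightarrow> nat \<Rightarrow> (nat \<Rightarrow> nat) pmf" where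
  "fresh_labels chi N = Pi_pmf {..top_oram chi N} 0 (random_label chi N)"

text \<open>An execution lists, for each operation, the state at its end and the transferred buckets.\<close>

type_synonym 'v execution = "('v rec_oram \<times> 'v transfer) list"

fun run_from ::
  "nat \<Rightarrow> nat \<Rightarrow> 'v policy \<Rightarrow> (nat \<Rightarrow> 'v) \<Rightarrow> (nat \<times> nat \<Rightarrow> nat) \<Rightarrow> 'v operation list
    \<Rightarrow> 'v rec_oram \<Rightarrow> 'v execution pmf" where
  "run_from chi N pick d0 ini [] s = return_pmf []"
| "run_from chi N pick d0 ini (opn # ops) s =
     bind_pmf (fresh_labels chi N) (\<lambda>fresh.
       let (s', Ts) = perform chi N pick d0 ini opn fresh s
       in map_pmf ((#) (s', Ts)) (run_from chi N pick d0 ini ops s'))"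

definition run ::
  "nat \<Rightarrow> nat \<Rightarrow> 'v policy \<Rightarrow> (nat \<Rightarrow> 'v) \<Rightarrow> 'v operation list \<Rightarrow> 'v execution pmf" where
  "run chi N pick d0 ops =
     bind_pmf (initial_labels chi N)
       (\<lambda>ini. run_from chi N pick d0 ini ops (initial_state chi N ini))"

section \<open>Costs\<close>

definition blocks_transferred :: "'v bucket list \<Rightarrow> nat" where
  "blocks_transferred T = (\<Sum>K\<leftarrow>T. size K)"

definition regular_transferred :: "'v transfer \<Rightarrow> nat" where
  "regular_transferred Ts = blocks_transferred (Ts 0)"

definition small_transferred :: "nat \<Rightarrow> nat \<Rightarrow> 'v transfer \<Rightarrow> nat" where
  "small_transferred chi N Ts = (\<Sum>i = 1..top_oram chi N. blocks_transferred (Ts i))"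

definition small_block_bits :: "nat \<Rightarrow> nat \<Rightarrow> nat" where
  "small_block_bits chi N = chi * nat \<lceil>log 2 (real N)\<rceil>"

text \<open>The total size of \<open>m\<close> small blocks and \<open>r\<close> regular blocks of \<open>b\<close> bits, in regular blocks.\<close>

definition in_regular_blocks :: "nat \<Rightarrow> nat \<Rightarrow> nat \<Rightarrow> nat \<Rightarrow> nat \<Rightarrow> real" where
  "in_regular_blocks chi N b m r = real (m * small_block_bits chi N + r * b) / real b"

text \<open>
  \<open>cap i\<close> is the capacity of the stash of ORAM \<open>i\<close>. A small block stores \<open>chi\<close> labels, which
  gives the second summand, the space for the position map kept by the client.
\<close>

definition small_storage :: "nat \<Rightarrow> nat \<Rightarrow> (nat \<Rightarrow> nat) \<Rightarrow> nat" where
  "small_storage chi N cap =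
     (\<Sum>i = 1..top_oram chi N. cap i) + nat \<lceil>real (num_blocks chi N (top_oram chi N)) / real chi\<rceil>"

definition regular_storage :: "(nat \<Rightarrow> nat) \<Rightarrow> nat" where
  "regular_storage cap = cap 0"

definition storage_exceeded :: "nat \<Rightarrow> nat \<Rightarrow> (nat \<Rightarrow> nat) \<Rightarrow> 'v execution \<Rightarrow> bool" where
  "storage_exceeded chi N cap E \<longleftrightarrow>
     (\<exists>(s, Ts)\<in>set E. \<exists>i\<le>top_oram chi N. cap i < card (stash (oram s i)))"

definition failure_prob ::
  "nat \<Rightarrow> nat \<Rightarrow> (nat \<Rightarrow> nat) \<Rightarrow> 'v policy \<Rightarrow> (nat \<Rightarrow> 'v) \<Rightarrow> 'v operation list \<Rightarrow> real" where
  "failure_prob chi N cap pick d0 ops =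
     measure_pmf.prob (run chi N pick d0 ops) {E. storage_exceeded chi N cap E}"

text \<open>\<open>p(N) \<le> N\<close> to the power \<open>-\<omega>(1)\<close>\<close>

definition superpoly_small :: "(nat \<Rightarrow> real) \<Rightarrow> bool" where
  "superpoly_small p \<longleftrightarrow> (\<exists>g :: nat \<Rightarrow> real. filterlim g at_top at_top \<and>
     (\<forall>\<^sub>F N in at_top. p N \<le> real N powr (- g N)))"

definition poly_bounded :: "(nat \<Rightarrow> nat) \<Rightarrow> bool" where
  "poly_bounded T \<longleftrightarrow> (\<exists>k. (\<lambda>N. real (T N)) \<in> O(\<lambda>N. real N ^ k))"

end

theory Submission
  imports Defs
begin

text \<open>
  In an ORAM with unbounded buckets a block lies at the deepest level that its path shares with a
  path read since its last access. In the real ORAM the buckets between the actual position of a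
  block and that ideal position are full, so if \<open>T\<close> is the set of nodes all of whose ancestors are
  full, then the stash together with the \<open>5 |T|\<close> blocks in \<open>T\<close> is contained in the set of blocks
  whose ideal position lies in \<open>T\<close>. This holds for every eviction policy, hence the stash is
  bounded by a function of the labels of this ORAM alone, although the policy may depend on the
  contents of the blocks and thereby on the labels of other ORAMs.

  For a fixed \<open>T\<close>, order the blocks by their last access, the most recent one first. The labels read
  and drawn at the last accesses are independent and uniform. A block stays in \<open>T\<close> only if the
  child of \<open>T\<close> through which its path leaves \<open>T\<close> has not been hit by a label read since then. Each
  such exit node contributes about a geometric variable with parameter 1/2, whose moment generating
  function at 5/3 is 3, and there are at most \<open>|T| + 1\<close> exit nodes. With the Chernoff factor
  \<open>(3/5)\<^sup>5\<close> per full bucket, \<open>T\<close> gets the weight \<open>3 (3/5)\<^sup>R (729/3125)\<^bsup>|T|\<^esup>\<close>, and the union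
  bound over all \<open>T\<close> converges since \<open>729/3125 < 1/4\<close>.
\<close>

text \<open>The base 5/3 comes from the bucket size. With Chernoff base \<open>t\<close>, a node of
  \<open>T\<close> gains \<open>t^5\<close> from its full bucket and costs
  \<open>1 / (2 - t)\<close>, the generating function of a geometric variable, and
  \<open>t^5 * (2 - t)\<close> is largest at \<open>t = 5/3\<close>. Its value 3125/729 exceeds 4,
  the growth rate of the number of binary trees; for buckets of size 4 the corresponding maximum
  stays below 4. The obstacle is that labels are reused: the leaf read by an access is the label
  drawn at the previous access to the same address. Keeping only the last access to each address
  gives every label at most one role, and ignoring the other reads can only enlarge the count of
  surviving blocks. A path that ends in a leaf of \<open>T\<close> has no exit that a read could
  hit, so blocks with such labels are counted in full. As there are at least as many leaves as
  blocks, at most one such block is expected per leaf of \<open>T\<close>, and every leaf of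
  \<open>T\<close> lowers the bound on the number of exits by two.\<close>

section \<open>Survivors of a random marking\<close>

text \<open>A pair \<open>(\<rho>, \<eta>)\<close> names the labels read and drawn at one access,
  and the list goes back in time. \<open>A\<close> holds the exit classes that no later read has
  hit, \<open>B\<close> the classes that no read removes. The class of \<open>\<rho>\<close> is
  removed before \<open>\<eta>\<close> is tested because an access writes its path back after
  relabelling its block.\<close>

fun survivors :: "('l \<Rightarrow> 'c) \<Rightarrow> 'c set \<Rightarrow> 'c set \<Rightarrow> ('k \<times> 'k) list \<Rightarrow> ('k \<Rightarrow> 'l) \<Rightarrow> nat" where
  "survivors ex B A [] w = 0"
| "survivors ex B A ((\<rho>, \<eta>) # js) w =
     (if ex (w \<eta>) \<in> (A - {ex (w \<rho>)}) \<union> B then 1 else 0) + survivors ex B (A - {ex (w \<rho>)}) js w"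

definition indices :: "('k \<times> 'k) list \<Rightarrow> 'k list" where
  "indices js = concat (map (\<lambda>(\<rho>, \<eta>). [\<rho>, \<eta>]) js)"

lemma indices_simps [simp]:
  "indices [] = []"
  "indices ((\<rho>, \<eta>) # js) = \<rho> # \<eta> # indices js"
  by (auto simp: indices_def)

lemma survivors_cong:
  assumes "\<And>k. k \<in> set (indices js) \<Longrightarrow> w k = w' k"
  shows "survivors ex B A js w = survivors ex B A js w'"
  using assms
proof (induction js arbitrary: A)
  case (Cons p js)
  obtain \<rho> \<eta> where [simp]: "p = (\<rho>, \<eta>)"
    by (cases p)
  have *: "w \<rho> = w' \<rho>" "w \<eta> = w' \<eta>"
    using Cons.prems[of \<rho>] Cons.prems[of \<eta>] by auto
  have "survivors ex B A' js w = survivors ex B A' js w'" for A'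
    using Cons.prems by (intro Cons.IH) auto
  then show ?case
    using * by simp
qed auto

lemma expectation_Pi_pmf_insert:
  fixes h :: "('k \<Rightarrow> 'l) \<Rightarrow> real"
  assumes "finite I" "k \<notin> I" "finite S" "S \<noteq> {}"
  shows "measure_pmf.expectation (Pi_pmf (insert k I) d (\<lambda>_. pmf_of_set S)) h =
    (\<Sum>u\<in>S. measure_pmf.expectation (Pi_pmf I d (\<lambda>_. pmf_of_set S)) (\<lambda>w. h (w(k := u)))) / card S"
proof -
  have fin: "finite (set_pmf (Pi_pmf I d (\<lambda>_. pmf_of_set S)))"
    using assms by (intro finite_subset[OF set_Pi_pmf_subset'] finite_PiE_dflt) auto
  have "Pi_pmf (insert k I) d (\<lambda>_. pmf_of_set S) =
      pmf_of_set S \<bind> (\<lambda>u. map_pmf (\<lambda>w. w(k := u)) (Pi_pmf I d (\<lambda>_. pmf_of_set S)))"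
    using assms by (simp add: Pi_pmf_insert' map_pmf_def)
  then show ?thesis
    using assms fin
    by (simp add: pmf_expectation_bind_pmf_of_set divide_inverse sum_distrib_left mult.commute)
qed

lemma sum_if_const:
  fixes x y :: real
  assumes "finite S"
  shows "(\<Sum>v\<in>S. if P v then x else y) = card {v\<in>S. P v} * x + (real (card S) - card {v\<in>S. P v}) * y"
proof -
  have "S \<inter> {v. P v} = {v\<in>S. P v}" "S \<inter> - {v. P v} = S - {v\<in>S. P v}" "S \<inter> {v. \<not> P v} = S - {v\<in>S. P v}"
    by auto
  moreover have "card (S - {v\<in>S. P v}) = card S - card {v\<in>S. P v}"
    using assms by (intro card_Diff_subset) auto
  ultimately show ?thesis
    using assms by (simp add: sum.If_cases card_mono of_nat_diff)
qed

text \<open>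
  One step of the marking: the loss of a factor 3 when a class of \<open>A\<close> is hit by the first
  label pays for the factor 5/3 that is gained when a class of \<open>A\<close> is hit by the second.
\<close>

lemma survivors_step:
  fixes ex :: "'l \<Rightarrow> 'c"
  assumes "finite S" "S \<noteq> {}" "finite A" "A \<inter> B = {}"
  defines "q \<equiv> real (card {v\<in>S. ex v \<in> B}) / card S"
  shows "(\<Sum>u\<in>S. \<Sum>v\<in>S. (if ex v \<in> (A - {ex u}) \<union> B then 5/3 else 1) * 3 ^ card (A - {ex u}) :: real)
    \<le> (real (card S))\<^sup>2 * (3 ^ card A * (1 + 2/3 * q))"
proof -
  define s where "s = real (card S)"
  define p where "p = real (card {v\<in>S. ex v \<in> A}) / s"
  have s: "s > 0"
    using assms by (simp add: s_def card_gt_0_iff)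
  have pq: "p \<ge> 0" "q \<ge> 0"
    using s by (auto simp: p_def q_def s_def)
  have inner: "(\<Sum>v\<in>S. (if ex v \<in> (A - {ex u}) \<union> B then 5/3 else 1) :: real) \<le> s * (1 + 2/3 * (p + q))" for u
  proof -
    \<comment> \<open>Testing against all of \<open>A\<close> instead of \<open>A - {ex u}\<close>
      makes the bound independent of \<open>u\<close>, so the double sum factorises.\<close>
    have "(\<Sum>v\<in>S. (if ex v \<in> (A - {ex u}) \<union> B then 5/3 else 1) :: real)
        \<le> (\<Sum>v\<in>S. 1 + 2/3 * (if ex v \<in> A then 1 else 0) + 2/3 * (if ex v \<in> B then 1 else 0))"
      by (intro sum_mono) auto
    also have "\<dots> = s + 2/3 * (s * p) + 2/3 * (s * q)"
      unfolding sum.distrib sum_distrib_left[symmetric] using assms s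
      by (simp add: sum_if_const p_def q_def s_def)
    finally show ?thesis
      by (simp add: field_simps)
  qed
  have pow: "(3::real) ^ card (A - {ex u}) = 3 ^ card A * (if ex u \<in> A then 1/3 else 1)" for u
  proof (cases "ex u \<in> A")
    case True
    then have "card A = Suc (card (A - {ex u}))"
      using assms by (metis card_Suc_Diff1)
    then have "(3::real) ^ card A = 3 * 3 ^ card (A - {ex u})"
      by (metis power_Suc)
    with True show ?thesis
      by simp
  qed auto
  have "(\<Sum>u\<in>S. \<Sum>v\<in>S. (if ex v \<in> (A - {ex u}) \<union> B then 5/3 else 1) * 3 ^ card (A - {ex u}) :: real)
      = (\<Sum>u\<in>S. (\<Sum>v\<in>S. (if ex v \<in> (A - {ex u}) \<union> B then 5/3 else 1)) * 3 ^ card (A - {ex u}))"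
    by (simp add: sum_distrib_right)
  also have "\<dots> \<le> (\<Sum>u\<in>S. s * (1 + 2/3 * (p + q)) * (3 ^ card A * (if ex u \<in> A then 1/3 else 1)))"
    using inner pow s pq by (intro sum_mono mult_mono) (auto intro!: sum_nonneg mult_nonneg_nonneg)
  also have "\<dots> = s * (1 + 2/3 * (p + q)) * (3 ^ card A * (\<Sum>u\<in>S. if ex u \<in> A then 1/3 else 1))"
    by (simp add: sum_distrib_left)
  also have "(\<Sum>u\<in>S. if ex u \<in> A then 1/3 else 1 :: real) = s * (1 - 2/3 * p)"
    using assms s by (simp add: sum_if_const p_def s_def field_simps)
  also have "s * (1 + 2/3 * (p + q)) * (3 ^ card A * (s * (1 - 2/3 * p)))
      = s\<^sup>2 * (3 ^ card A * ((1 + 2/3 * (p + q)) * (1 - 2/3 * p)))"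
    by (simp add: power2_eq_square)
  also have "\<dots> \<le> s\<^sup>2 * (3 ^ card A * (1 + 2/3 * q))"
  proof -
    \<comment> \<open>The gain \<open>2/3 * p\<close> from a draw and the loss
      \<open>2/3 * p\<close> from a read cancel to first order because
      \<open>5/3 - 1 = 1 - 1/3\<close>; only negative products are left over.\<close>
    have "(1 + 2/3 * (p + q)) * (1 - 2/3 * p) = 1 + 2/3 * q - 4/9 * (p * p + p * q)"
      by (simp add: field_simps)
    also have "\<dots> \<le> 1 + 2/3 * q"
      using pq by simp
    finally show ?thesis
      by (intro mult_left_mono) auto
  qed
  finally show ?thesis
    by (simp add: s_def)
qed

text \<open>Fixing the two labels of the newest access leaves the others independent, because all
  indices are distinct; \<open>survivors_step\<close> then carries the potential
  \<open>3 ^ card A\<close> back in time.\<close>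

lemma expectation_survivors:
  fixes ex :: "'l \<Rightarrow> 'c" and js :: "('k \<times> 'k) list"
  assumes "finite I" "finite S" "S \<noteq> {}" "finite A" "A \<inter> B = {}"
    and "distinct (indices js)" "set (indices js) \<subseteq> I"
  defines "q \<equiv> real (card {v\<in>S. ex v \<in> B}) / card S"
  shows "measure_pmf.expectation (Pi_pmf I d (\<lambda>_. pmf_of_set S)) (\<lambda>w. (5/3) ^ survivors ex B A js w)
    \<le> 3 ^ card A * (1 + 2/3 * q) ^ length js"
  using assms(1,4-7)
proof (induction js arbitrary: A I)
  case Nil
  then show ?case
    by (simp add: one_le_power)
next
  case (Cons p js)
  obtain \<rho> \<eta> where p [simp]: "p = (\<rho>, \<eta>)"
    by (cases p)
  define J where "J = I - {\<rho>, \<eta>}"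
  have I: "I = insert \<rho> (insert \<eta> J)" "\<rho> \<notin> insert \<eta> J" "\<eta> \<notin> J" "finite J" "\<rho> \<noteq> \<eta>"
    and js: "distinct (indices js)" "set (indices js) \<subseteq> J"
    using Cons.prems by (auto simp: J_def)
  define K where "K = (1 + 2/3 * q) ^ length js"
  have K: "K \<ge> 0"
    by (auto simp: K_def q_def)
  have s: "real (card S) > 0"
    using assms by (simp add: card_gt_0_iff)
  let ?P = "Pi_pmf J d (\<lambda>_. pmf_of_set S)"
  let ?c = "\<lambda>u v. if ex v \<in> (A - {ex u}) \<union> B then 5/3 else 1 :: real"
  have inner: "measure_pmf.expectation ?P (\<lambda>w. (5/3) ^ survivors ex B A (p # js) (w(\<eta> := v, \<rho> := u)))
      \<le> ?c u v * 3 ^ card (A - {ex u}) * K" for u v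
  proof -
    have "survivors ex B A' js (w(\<eta> := v, \<rho> := u)) = survivors ex B A' js w" for A' w
      using I js by (intro survivors_cong) auto
    then have "measure_pmf.expectation ?P (\<lambda>w. (5/3) ^ survivors ex B A (p # js) (w(\<eta> := v, \<rho> := u)))
        = measure_pmf.expectation ?P (\<lambda>w. ?c u v * (5/3) ^ survivors ex B (A - {ex u}) js w)"
      using I by (intro arg_cong[where f = "integral\<^sup>L _"] ext) (auto simp: power_add)
    also have "\<dots> = ?c u v * measure_pmf.expectation ?P (\<lambda>w. (5/3) ^ survivors ex B (A - {ex u}) js w)"
      by (rule integral_mult_right_zero)
    also have "\<dots> \<le> ?c u v * (3 ^ card (A - {ex u}) * K)"
      unfolding K_def using Cons.prems I js by (intro mult_left_mono Cons.IH) auto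
    finally show ?thesis
      by (simp add: mult.assoc)
  qed
  have "measure_pmf.expectation (Pi_pmf I d (\<lambda>_. pmf_of_set S)) (\<lambda>w. (5/3) ^ survivors ex B A (p # js) w)
      = (\<Sum>u\<in>S. (\<Sum>v\<in>S. measure_pmf.expectation ?P
          (\<lambda>w. (5/3) ^ survivors ex B A (p # js) (w(\<eta> := v, \<rho> := u)))) / card S) / card S"
    unfolding I(1) using I assms by (subst expectation_Pi_pmf_insert) (auto simp: expectation_Pi_pmf_insert simp del: survivors.simps)
  also have "\<dots> \<le> (\<Sum>u\<in>S. (\<Sum>v\<in>S. ?c u v * 3 ^ card (A - {ex u}) * K) / card S) / card S"
    using s by (intro divide_right_mono sum_mono inner) auto
  also have "\<dots> = (\<Sum>u\<in>S. \<Sum>v\<in>S. ?c u v * 3 ^ card (A - {ex u})) * (K / (real (card S))\<^sup>2)"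
    by (simp add: sum_divide_distrib[symmetric] sum_distrib_right[symmetric] power2_eq_square)
  also have "\<dots> \<le> (real (card S))\<^sup>2 * (3 ^ card A * (1 + 2/3 * q)) * (K / (real (card S))\<^sup>2)"
    unfolding q_def using Cons.prems assms K
    by (intro mult_right_mono survivors_step) auto
  also have "\<dots> = 3 ^ card A * (1 + 2/3 * q) ^ length (p # js)"
    using s by (simp add: K_def)
  finally show ?case .
qed

text \<open>Exponential Markov inequality with base 5/3.\<close>

lemma prob_survivors_ge:
  fixes ex :: "'l \<Rightarrow> 'c" and js :: "('k \<times> 'k) list"
  assumes "finite I" "finite S" "S \<noteq> {}" "finite A" "A \<inter> B = {}"
    and "distinct (indices js)" "set (indices js) \<subseteq> I"
  shows "measure_pmf.prob (Pi_pmf I d (\<lambda>_. pmf_of_set S)) {w. k \<le> survivors ex B A js w}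
    \<le> (3/5) ^ k * (3 ^ card A * (1 + 2/3 * (real (card {v\<in>S. ex v \<in> B}) / card S)) ^ length js)"
proof -
  let ?P = "Pi_pmf I d (\<lambda>_. pmf_of_set S)"
  have fin: "finite (set_pmf ?P)"
    using assms by (intro finite_subset[OF set_Pi_pmf_subset'] finite_PiE_dflt) auto
  have "measure_pmf.prob ?P {w. k \<le> survivors ex B A js w}
      = measure_pmf.expectation ?P (indicator {w. k \<le> survivors ex B A js w})"
    by simp
  also have "\<dots> \<le> measure_pmf.expectation ?P (\<lambda>w. (3/5) ^ k * (5/3) ^ survivors ex B A js w)"
  proof (intro integral_mono integrable_measure_pmf_finite fin)
    fix w
    have "1 = (3/5 :: real) ^ k * (5/3) ^ k"
      by (simp flip: power_mult_distrib)
    also have "\<dots> \<le> (3/5) ^ k * (5/3) ^ survivors ex B A js w" if "k \<le> survivors ex B A js w"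
      using that by (intro mult_left_mono power_increasing) auto
    finally show "indicator {w. k \<le> survivors ex B A js w} w \<le> (3/5 :: real) ^ k * (5/3) ^ survivors ex B A js w"
      by (auto split: split_indicator)
  qed
  also have "\<dots> = (3/5) ^ k * measure_pmf.expectation ?P (\<lambda>w. (5/3) ^ survivors ex B A js w)"
    by (rule integral_mult_right_zero)
  also have "\<dots> \<le> (3/5) ^ k * (3 ^ card A * (1 + 2/3 * (real (card {v\<in>S. ex v \<in> B}) / card S)) ^ length js)"
    using assms by (intro mult_left_mono expectation_survivors) auto
  finally show ?thesis .
qed

section \<open>Subtrees containing the root\<close>

text \<open>Closure under parents makes every nonempty member contain the root. The empty set is a
  member too; it is the witness for an overflow when the root bucket is not full.\<close>

definition top_subtrees :: "nat \<Rightarrow> (nat \<times> nat) set set" where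
  "top_subtrees L = {T. (\<forall>l k. (l, k) \<in> T \<longrightarrow> l \<le> L \<and> k < 2 ^ l) \<and>
                    (\<forall>l k. (Suc l, k) \<in> T \<longrightarrow> (l, k div 2) \<in> T)}"

text \<open>The part of the subtree below \<open>(l, k)\<close> on the \<open>d\<close> levels from
  \<open>l\<close> on. The cones of two siblings are disjoint, which makes cardinalities additive in
  the recursion over trees.\<close>

definition cone :: "nat \<Rightarrow> nat \<Rightarrow> nat \<Rightarrow> (nat \<times> nat) set" where
  "cone d l k = {(l', k'). l \<le> l' \<and> l' < l + d \<and> k' div 2 ^ (l' - l) = k}"

fun subtrees_from :: "nat \<Rightarrow> nat \<Rightarrow> nat \<Rightarrow> (nat \<times> nat) set set" where
  "subtrees_from 0 l k = {{}}"
| "subtrees_from (Suc d) l k =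
     insert {} ((\<lambda>(T1, T2). insert (l, k) (T1 \<union> T2)) `
       (subtrees_from d (Suc l) (2 * k) \<times> subtrees_from d (Suc l) (Suc (2 * k))))"

lemma cone_Suc:
  "cone (Suc d) l k = insert (l, k) (cone d (Suc l) (2 * k) \<union> cone d (Suc l) (Suc (2 * k)))"
proof -
  have "(k' div 2 ^ (l' - l) = k) = (k' div 2 ^ (l' - Suc l) = 2 * k \<or> k' div 2 ^ (l' - Suc l) = Suc (2 * k))"
    if "Suc l \<le> l'" for l' k'
  proof -
    have "l' - l = Suc (l' - Suc l)"
      using that by simp
    then have "k' div 2 ^ (l' - l) = k' div 2 ^ (l' - Suc l) div 2"
      by (simp only: power_Suc2 div_mult2_eq)
    moreover have "n div 2 = k \<longleftrightarrow> n = 2 * k \<or> n = Suc (2 * k)" for n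
      by presburger
    ultimately show ?thesis
      by simp
  qed
  note * = this
  have "(l', k') \<in> cone (Suc d) l k \<longleftrightarrow>
      (l', k') \<in> insert (l, k) (cone d (Suc l) (2 * k) \<union> cone d (Suc l) (Suc (2 * k)))" for l' k'
  proof (cases "Suc l \<le> l'")
    case True
    then show ?thesis
      using *[OF True] by (auto simp: cone_def)
  qed (auto simp: cone_def)
  then show ?thesis
    by auto
qed

lemma subtrees_from_cone: "T \<in> subtrees_from d l k \<Longrightarrow> finite T \<and> T \<subseteq> cone d l k"
proof (induction d l k arbitrary: T rule: subtrees_from.induct)
  case (2 d l k)
  from 2(3) consider "T = {}" | T1 T2 where "T = insert (l, k) (T1 \<union> T2)"
    "T1 \<in> subtrees_from d (Suc l) (2 * k)" "T2 \<in> subtrees_from d (Suc l) (Suc (2 * k))"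
    by auto
  then show ?case
  proof cases
    case (2 T1 T2)
    then show ?thesis
      using \<open>\<And>T. T \<in> subtrees_from d (Suc l) (2 * k) \<Longrightarrow> _\<close>[of T1]
        \<open>\<And>T. T \<in> subtrees_from d (Suc l) (Suc (2 * k)) \<Longrightarrow> _\<close>[of T2]
      unfolding cone_Suc by blast
  qed auto
qed auto

lemma finite_subtrees_from: "finite (subtrees_from d l k)"
  by (induction d l k rule: subtrees_from.induct) auto

text \<open>Splitting at the root gives a recursion \<open>F' \<le> 1 + \<alpha> * F * F\<close> for
  the generating function, as for Catalan numbers. At the radius of convergence
  \<open>\<alpha> = 1/4\<close> it has the fixed point 2, so the bound 2 is preserved by the
  induction over the depth.\<close>

lemma sum_subtrees_from:
  assumes "0 \<le> \<alpha>" "\<alpha> \<le> 1/4"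
  shows "(\<Sum>T\<in>subtrees_from d l k. \<alpha> ^ card T) \<le> (2 :: real)"
proof (induction d l k rule: subtrees_from.induct)
  case (2 d l k)
  let ?S1 = "subtrees_from d (Suc l) (2 * k)" and ?S2 = "subtrees_from d (Suc l) (Suc (2 * k))"
  let ?f = "\<lambda>(T1, T2). insert (l, k) (T1 \<union> T2)"
  have card: "card (?f p) = Suc (card (fst p) + card (snd p))" if "p \<in> ?S1 \<times> ?S2" for p
  proof -
    have "cone d (Suc l) (2 * k) \<inter> cone d (Suc l) (Suc (2 * k)) = {}"
      "(l, k) \<notin> cone d (Suc l) (2 * k)" "(l, k) \<notin> cone d (Suc l) (Suc (2 * k))"
      by (auto simp: cone_def)
    moreover have "finite (fst p) \<and> fst p \<subseteq> cone d (Suc l) (2 * k)"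
      "finite (snd p) \<and> snd p \<subseteq> cone d (Suc l) (Suc (2 * k))"
      using that by (auto dest!: subtrees_from_cone)
    ultimately have "finite (fst p)" "finite (snd p)" "fst p \<inter> snd p = {}" "(l, k) \<notin> fst p \<union> snd p"
      by blast+
    then show ?thesis
      by (simp add: case_prod_beta card_Un_disjoint)
  qed
  have "(\<Sum>T\<in>subtrees_from (Suc d) l k. \<alpha> ^ card T) \<le> 1 + (\<Sum>T\<in>?f ` (?S1 \<times> ?S2). \<alpha> ^ card T)"
    using finite_subtrees_from by (simp add: sum.insert_if)
  also have "(\<Sum>T\<in>?f ` (?S1 \<times> ?S2). \<alpha> ^ card T) \<le> (\<Sum>p\<in>?S1 \<times> ?S2. \<alpha> ^ card (?f p))"
    using assms finite_subtrees_from by (intro order_trans[OF sum_image_le]) auto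
  also have "\<dots> = (\<Sum>p\<in>?S1 \<times> ?S2. \<alpha> * (\<alpha> ^ card (fst p) * \<alpha> ^ card (snd p)))"
    by (intro sum.cong refl) (simp only: card, simp add: power_add)
  also have "\<dots> = \<alpha> * ((\<Sum>T\<in>?S1. \<alpha> ^ card T) * (\<Sum>T\<in>?S2. \<alpha> ^ card T))"
    by (subst sum_product) (simp add: sum.cartesian_product sum_distrib_left case_prod_beta)
  also have "\<dots> \<le> 1/4 * (2 * 2)"
    using assms 2 by (intro mult_mono) (auto intro!: sum_nonneg mult_nonneg_nonneg)
  finally show ?case
    by simp
qed simp

text \<open>Closure is demanded only strictly below the apex level, because the intersection of
  \<open>T\<close> with the cone of a child does not contain the parent of that child.\<close>

lemma closed_in_subtrees_from:
  assumes "T \<subseteq> cone d l k" "\<And>l' k'. (Suc l', k') \<in> T \<Longrightarrow> l \<le> l' \<Longrightarrow> (l', k' div 2) \<in> T"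
  shows "T \<in> subtrees_from d l k"
  using assms
proof (induction d l k arbitrary: T rule: subtrees_from.induct)
  case (1 l k)
  then show ?case
    by (auto simp: cone_def)
next
  case (2 d l k)
  have sub: "T \<inter> cone d (Suc l) k' \<in> subtrees_from d (Suc l) k'"
    if IH: "\<And>T'. T' \<subseteq> cone d (Suc l) k' \<Longrightarrow> (\<And>l' j. (Suc l', j) \<in> T' \<Longrightarrow> Suc l \<le> l' \<Longrightarrow> (l', j div 2) \<in> T')
        \<Longrightarrow> T' \<in> subtrees_from d (Suc l) k'" for k'
  proof (rule IH)
    fix l' j
    assume *: "(Suc l', j) \<in> T \<inter> cone d (Suc l) k'" "Suc l \<le> l'"
    have "Suc l' - Suc l = Suc (l' - Suc l)"
      using * by simp
    then have "j div 2 ^ (Suc l' - Suc l) = j div 2 div 2 ^ (l' - Suc l)"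
      by (simp only: power_Suc div_mult2_eq)
    then show "(l', j div 2) \<in> T \<inter> cone d (Suc l) k'"
      using * 2(4)[of l' j] by (auto simp: cone_def)
  qed auto
  have root: "(l, k) \<in> T" if "(l + e, k') \<in> T" for e k'
    using that
  proof (induction e arbitrary: k')
    case 0
    then show ?case
      using 2(3) by (auto simp: cone_def)
  next
    case (Suc e)
    then show ?case
      using 2(4)[of "l + e" k'] by auto
  qed
  show ?case
  proof (cases "T = {}")
    case False
    then obtain l' k' where "(l', k') \<in> T"
      by auto
    then have "(l, k) \<in> T"
      using root[of "l' - l" k'] 2(3) by (auto simp: cone_def)
    then have "T = insert (l, k) ((T \<inter> cone d (Suc l) (2 * k)) \<union> (T \<inter> cone d (Suc l) (Suc (2 * k))))"
      using 2(3) unfolding cone_Suc by blast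
    moreover have "(T \<inter> cone d (Suc l) (2 * k), T \<inter> cone d (Suc l) (Suc (2 * k))) \<in>
        subtrees_from d (Suc l) (2 * k) \<times> subtrees_from d (Suc l) (Suc (2 * k))"
      using sub[OF 2(1)] sub[OF 2(2)] by (rule SigmaI)
    ultimately show ?thesis
      unfolding subtrees_from.simps
      by (intro insertI2 image_eqI[where x = "(T \<inter> cone d (Suc l) (2 * k), T \<inter> cone d (Suc l) (Suc (2 * k)))"]) simp
  qed auto
qed

lemma top_subtrees_subset: "top_subtrees L \<subseteq> subtrees_from (Suc L) 0 0"
proof
  fix T assume T: "T \<in> top_subtrees L"
  then have "T \<subseteq> cone (Suc L) 0 0"
    by (force simp: top_subtrees_def cone_def)
  with T show "T \<in> subtrees_from (Suc L) 0 0"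
    by (rule_tac closed_in_subtrees_from) (simp_all add: top_subtrees_def)
qed

lemma finite_top_subtrees: "finite (top_subtrees L)"
  by (rule finite_subset[OF top_subtrees_subset finite_subtrees_from])

lemma finite_top_subtree: "T \<in> top_subtrees L \<Longrightarrow> finite T"
  using top_subtrees_subset subtrees_from_cone by blast

lemma sum_top_subtrees:
  assumes "0 \<le> \<alpha>" "\<alpha> \<le> 1/4"
  shows "(\<Sum>T\<in>top_subtrees L. \<alpha> ^ card T) \<le> (2 :: real)"
  using assms
  by (intro order_trans[OF sum_mono2[OF finite_subtrees_from top_subtrees_subset] sum_subtrees_from]) auto

section \<open>Paths and the nodes through which they leave a subtree\<close>

lemma path_node_parent:
  assumes "l < L"
  shows "path_node L y l = (l, snd (path_node L y (Suc l)) div 2)"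
proof -
  have "L - l = Suc (L - Suc l)"
    using assms by simp
  then have "y div 2 ^ (L - l) = y div 2 ^ (L - Suc l) div 2"
    by (simp only: power_Suc2 div_mult2_eq)
  then show ?thesis
    by (simp add: path_node_def)
qed

lemma path_node_level [simp]: "fst (path_node L y l) = l"
  by (simp add: path_node_def)

lemma path_node_bound: "l \<le> L \<Longrightarrow> y < 2 ^ L \<Longrightarrow> snd (path_node L y l) < 2 ^ l"
  by (simp add: path_node_def less_mult_imp_div_less power_add[symmetric])

lemma path_node_agree_above:
  assumes "path_node L x l = path_node L y l" "l' \<le> l" "l \<le> L"
  shows "path_node L x l' = path_node L y l'"
  using assms(2)
proof (induction rule: inc_induct)
  case base
  then show ?case
    by (rule assms(1))
next
  case (step n)
  then show ?case
    using assms(3) path_node_parent[of n L x] path_node_parent[of n L y] by simp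
qed

definition exit_level :: "nat \<Rightarrow> (nat \<times> nat) set \<Rightarrow> nat \<Rightarrow> nat" where
  "exit_level L T y = (LEAST l. path_node L y l \<notin> T)"

definition exit_node :: "nat \<Rightarrow> (nat \<times> nat) set \<Rightarrow> nat \<Rightarrow> nat \<times> nat" where
  "exit_node L T y = path_node L y (exit_level L T y)"

definition exits :: "nat \<Rightarrow> (nat \<times> nat) set \<Rightarrow> (nat \<times> nat) set" where
  "exits L T = {(l, k). l \<le> L \<and> k < 2 ^ l \<and> (l, k) \<notin> T \<and> (l = 0 \<or> (l - 1, k div 2) \<in> T)}"

text \<open>A path that ends in a leaf of \<open>T\<close> gets a fictitious exit node below the tree.\<close>

definition virtual_exits :: "nat \<Rightarrow> (nat \<times> nat) set" where
  "virtual_exits L = {v. fst v = Suc L}"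

lemma exit_level:
  assumes "T \<in> top_subtrees L"
  shows "exit_level L T y \<le> Suc L" "path_node L y (exit_level L T y) \<notin> T"
    "l < exit_level L T y \<Longrightarrow> path_node L y l \<in> T"
proof -
  \<comment> \<open>Truncated subtraction makes this node \<open>(Suc L, y)\<close>, which lies
    below the tree, so a first level outside \<open>T\<close> always exists.\<close>
  have "path_node L y (Suc L) \<notin> T"
    using assms by (force simp: path_node_def top_subtrees_def)
  then show "exit_level L T y \<le> Suc L" "path_node L y (exit_level L T y) \<notin> T"
    unfolding exit_level_def by (rule Least_le, rule LeastI)
  show "l < exit_level L T y \<Longrightarrow> path_node L y l \<in> T"
    unfolding exit_level_def using not_less_Least by blast
qed

lemma exit_node_in:
  assumes "T \<in> top_subtrees L" "y < 2 ^ L"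
  shows "exit_node L T y \<in> exits L T \<union> virtual_exits L"
proof (cases "exit_level L T y = Suc L")
  case False
  then have *: "exit_level L T y \<le> L"
    using exit_level(1)[OF assms(1), of y] by simp
  obtain l k where lk: "exit_node L T y = (l, k)"
    by (cases "exit_node L T y")
  then have l: "l = exit_level L T y"
    by (metis exit_node_def fst_conv path_node_level)
  have "(l - 1, k div 2) \<in> T" if "l \<noteq> 0"
    using that exit_level(3)[OF assms(1), of "l - 1" y] path_node_parent[of "l - 1" L y] lk l *
    by (auto simp: exit_node_def)
  then have "exit_node L T y \<in> exits L T"
    using * l lk exit_level(2)[OF assms(1), of y] path_node_bound[OF * assms(2)]
    by (auto simp: exits_def exit_node_def)
  then show ?thesis ..
qed (simp add: virtual_exits_def exit_node_def)

lemma exit_node_virtual: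
  assumes "T \<in> top_subtrees L" "exit_node L T y \<in> virtual_exits L"
  shows "(L, y) \<in> T"
  using exit_level(3)[OF assms(1), of L y] assms(2)
  by (simp add: virtual_exits_def exit_node_def path_node_def)

lemma exits_virtual_disjoint: "exits L T \<inter> virtual_exits L = {}"
  by (auto simp: exits_def virtual_exits_def)

lemma finite_exits: "finite (exits L T)"
proof (rule finite_subset)
  show "exits L T \<subseteq> (SIGMA l:{..L}. {..<2 ^ l})"
    by (auto simp: exits_def)
qed auto

text \<open>The root and the children of the nodes of \<open>T\<close> above the leaves number at
  most \<open>1 + 2 * card U\<close>, and among them lie all of \<open>T\<close> and, disjointly,
  all exits. A leaf of \<open>T\<close> contributes no children and thereby lowers the bound by
  two.\<close>

lemma card_exits:
  assumes "T \<in> top_subtrees L"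
  shows "card (exits L T) + 2 * card {y. (L, y) \<in> T} \<le> card T + 1"
proof -
  define U where "U = {v\<in>T. fst v < L}"
  define C where "C = insert (0, 0) ((\<lambda>((l, k), b). (Suc l, 2 * k + b)) ` (U \<times> {0, 1::nat}))"
  have fin: "finite T"
    using assms by (rule finite_top_subtree)
  have "card C \<le> Suc (card ((\<lambda>((l, k), b). (Suc l, 2 * k + b)) ` (U \<times> {0, 1::nat})))"
    unfolding C_def by (rule card_insert_le_m1) auto
  also have "card ((\<lambda>((l, k), b). (Suc l, 2 * k + b)) ` (U \<times> {0, 1::nat})) \<le> card (U \<times> {0, 1::nat})"
    using fin by (intro card_image_le) (auto simp: U_def)
  also have "card (U \<times> {0, 1::nat}) = 2 * card U"
    by (simp add: card_cartesian_product)
  finally have C: "card C \<le> 1 + 2 * card U"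
    by simp
  have inC: "(l, k) \<in> C" if "l \<le> L" "k < 2 ^ l" "l = 0 \<or> (l - 1, k div 2) \<in> T" for l k
  proof (cases l)
    case 0
    then show ?thesis
      using that by (simp add: C_def)
  next
    case (Suc l')
    then have "((l', k div 2), k mod 2) \<in> U \<times> {0, 1}"
      using that by (auto simp: U_def)
    then have "(Suc l', 2 * (k div 2) + k mod 2) \<in> C"
      unfolding C_def by (intro insertI2 image_eqI[where x = "((l', k div 2), k mod 2)"]) auto
    then show ?thesis
      using Suc by simp
  qed
  have "(l, k) \<in> C" if "(l, k) \<in> T" for l k
  proof (rule inC)
    show "l \<le> L" "k < 2 ^ l"
      using that assms by (auto simp: top_subtrees_def)
    show "l = 0 \<or> (l - 1, k div 2) \<in> T"
      using that assms by (cases l) (auto simp: top_subtrees_def)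
  qed
  then have TC: "T \<subseteq> C"
    by auto
  have EC: "exits L T \<subseteq> C - T"
    using inC by (auto simp: exits_def)
  have "finite C"
    using fin by (simp add: C_def U_def)
  then have "card (exits L T) \<le> card C - card T"
    using EC TC fin by (metis card_Diff_subset card_mono finite_Diff)
  moreover have "card T \<le> card C"
    using TC \<open>finite C\<close> by (rule card_mono[rotated])
  moreover have "card U + card {y. (L, y) \<in> T} = card T"
  proof -
    have "{v\<in>T. fst v = L} = Pair L ` {y. (L, y) \<in> T}"
      by auto
    then have "card {v\<in>T. fst v = L} = card {y. (L, y) \<in> T}"
      by (simp add: card_image inj_on_def)
    moreover have "card (U \<union> {v\<in>T. fst v = L}) = card U + card {v\<in>T. fst v = L}"
      using fin by (intro card_Un_disjoint) (auto simp: U_def)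
    moreover have "U \<union> {v\<in>T. fst v = L} = T"
      using assms by (auto simp: U_def top_subtrees_def order_less_le)
    ultimately show ?thesis
      by simp
  qed
  ultimately show ?thesis
    using C by linarith
qed

text \<open>If \<open>b\<close> leaves lie in \<open>T\<close>, a random label ends in one of them
  with probability \<open>q \<le> b / 2 ^ L\<close>. For \<open>m \<le> 2 ^ L\<close> the second
  factor is then at most \<open>exp 1 ^ b \<le> 3 ^ b\<close>, and by \<open>card_exits\<close> the
  exits that are missing because of these leaves pay for it.\<close>

lemma exits_factor_bound:
  assumes "T \<in> top_subtrees L" "m \<le> 2 ^ L"
  defines "q \<equiv> real (card {y\<in>{..<2 ^ L}. exit_node L T y \<in> virtual_exits L}) / card {..<2 ^ L :: nat}"
  shows "3 ^ card (exits L T) * (1 + 2/3 * q) ^ m \<le> (3 :: real) ^ (card T + 1)"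
proof -
  define b where "b = card {y. (L, y) \<in> T}"
  have "{y. (L, y) \<in> T} = Pair L -` T"
    by auto
  then have fin: "finite {y. (L, y) \<in> T}"
    using finite_top_subtree[OF assms(1)] by (simp add: finite_vimageI inj_on_def)
  have qb: "q \<le> b / 2 ^ L"
    unfolding q_def b_def using assms(1) fin
    by (auto intro!: divide_right_mono card_mono dest: exit_node_virtual)
  have q0: "q \<ge> 0"
    by (simp add: q_def)
  have qm: "q * m \<le> b"
  proof -
    have "real m \<le> 2 ^ L"
      using assms(2) by (metis of_nat_le_iff of_nat_numeral of_nat_power)
    then have "q * m \<le> b / 2 ^ L * 2 ^ L"
      using qb q0 by (intro mult_mono) auto
    then show ?thesis
      by simp
  qed
  have "(1 + 2/3 * q) ^ m \<le> exp (2/3 * q) ^ m"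
    using q0 by (intro power_mono exp_ge_add_one_self) auto
  also have "\<dots> = exp (2/3 * (q * m))"
    by (simp add: exp_of_nat_mult[symmetric] mult_ac)
  also have "\<dots> \<le> exp (real b * 1)"
    using qm by simp
  also have "\<dots> = exp 1 ^ b"
    by (rule exp_of_nat_mult)
  also have "\<dots> \<le> 3 ^ b"
    by (intro power_mono exp_le) auto
  finally have "3 ^ card (exits L T) * (1 + 2/3 * q) ^ m \<le> (3::real) ^ card (exits L T) * 3 ^ b"
    by (intro mult_left_mono) auto
  also have "\<dots> \<le> 3 ^ (card T + 1)"
    unfolding power_add[symmetric] using card_exits[OF assms(1)]
    by (intro power_increasing) (auto simp: b_def)
  finally show ?thesis .
qed

text \<open>The constant is \<open>6 = 3 * 2\<close>: a factor 3 for the one exit by which the exits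
  may outnumber the nodes of \<open>T\<close>, and 2 for the sum over all subtrees.\<close>

lemma prob_subtree_overfull:
  fixes js :: "('k \<times> 'k) list"
  assumes "finite I" "distinct (indices js)" "set (indices js) \<subseteq> I" "length js \<le> 2 ^ L"
  shows "measure_pmf.prob (Pi_pmf I d (\<lambda>_. pmf_of_set {..<2 ^ L}))
      {w. \<exists>T\<in>top_subtrees L. R + 5 * card T \<le> survivors (exit_node L T) (virtual_exits L) (exits L T) js w}
    \<le> 6 * (3/5) ^ R"
proof -
  let ?P = "Pi_pmf I d (\<lambda>_. pmf_of_set {..<2 ^ L})"
  let ?E = "\<lambda>T. {w. R + 5 * card T \<le> survivors (exit_node L T) (virtual_exits L) (exits L T) js w}"
  have "measure_pmf.prob ?P {w. \<exists>T\<in>top_subtrees L. R + 5 * card T \<le> survivors (exit_node L T) (virtual_exits L) (exits L T) js w}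
      = measure_pmf.prob ?P (\<Union>T\<in>top_subtrees L. ?E T)"
    by (intro arg_cong[where f = "measure_pmf.prob ?P"]) auto
  also have "\<dots> \<le> (\<Sum>T\<in>top_subtrees L. measure_pmf.prob ?P (?E T))"
    by (intro measure_pmf.finite_measure_subadditive_finite finite_top_subtrees) auto
  also have "\<dots> \<le> (\<Sum>T\<in>top_subtrees L. 3 * (3/5) ^ R * (729/3125) ^ card T)"
  proof (rule sum_mono)
    fix T assume T: "T \<in> top_subtrees L"
    have "measure_pmf.prob ?P (?E T) \<le> (3/5) ^ (R + 5 * card T) * (3 ^ card (exits L T) * (1 + 2/3 *
        (real (card {y\<in>{..<2 ^ L}. exit_node L T y \<in> virtual_exits L}) / card {..<2 ^ L :: nat})) ^ length js)"
      using assms finite_exits exits_virtual_disjoint by (intro prob_survivors_ge) (auto simp: lessThan_empty_iff)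
    also have "\<dots> \<le> (3/5) ^ (R + 5 * card T) * 3 ^ (card T + 1)"
      using T assms by (intro mult_left_mono exits_factor_bound) auto
    also have "\<dots> = 3 * (3/5) ^ R * ((3/5) ^ 5 * 3) ^ card T"
      by (simp add: power_add power_mult power_mult_distrib)
    also have "(3/5 :: real) ^ 5 * 3 = 729/3125"
      by (simp add: power_divide)
    finally show "measure_pmf.prob ?P (?E T) \<le> 3 * (3/5) ^ R * (729/3125) ^ card T" .
  qed
  also have "\<dots> = 3 * (3/5) ^ R * (\<Sum>T\<in>top_subtrees L. (729/3125) ^ card T)"
    by (simp add: sum_distrib_left)
  also have "\<dots> \<le> 3 * (3/5) ^ R * 2"
    by (intro mult_left_mono sum_top_subtrees) auto
  finally show ?thesis
    by simp
qed

section \<open>Access histories\<close>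

text \<open>A history lists the accessed addresses with their new labels, the most recent one first.\<close>

fun current :: "(nat \<Rightarrow> 'l) \<Rightarrow> (nat \<times> 'l) list \<Rightarrow> nat \<Rightarrow> 'l" where
  "current f [] a = f a"
| "current f ((a', y) # H) a = (if a = a' then y else current f H a)"

text \<open>The leaves whose paths have been read since the last access to \<open>a\<close>, that
  access included: its path is written back when \<open>a\<close> already has its new label. The
  leaf read by an access to \<open>a'\<close> is the label that \<open>a'\<close> had
  before.\<close>

fun reads_since :: "(nat \<Rightarrow> 'l) \<Rightarrow> (nat \<times> 'l) list \<Rightarrow> nat \<Rightarrow> 'l set" where
  "reads_since f [] a = {}"
| "reads_since f ((a', y) # H) a =
     insert (current f H a') (if a = a' then {} else reads_since f H a)"

text \<open>
  The indices of the old and of the new label of the last access to each address. The label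
  drawn for an address is replaced only when the same address is accessed again, hence all
  these indices are distinct.
\<close>

fun last_labels :: "nat set \<Rightarrow> (nat \<times> (nat + 'k)) list \<Rightarrow> ((nat + 'k) \<times> (nat + 'k)) list" where
  "last_labels D [] = []"
| "last_labels D ((a, k) # H) =
     (if a \<in> D then last_labels D H else (current Inl H a, k) # last_labels (insert a D) H)"

text \<open>Histories may carry names of labels instead of labels. Then
  \<open>current Inl H a\<close> is the name of the current label of \<open>a\<close>, with
  \<open>Inl a\<close> for the initial one, and \<open>w\<close> evaluates the names.\<close>

lemma current_map: "current (w \<circ> f) (map (apsnd w) H) a = w (current f H a)"
  by (induction H) auto

lemma current_cases:
  "(current f H a = f a \<and> a \<notin> fst ` set H) \<or> (a, current f H a) \<in> set H"
proof (induction H)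
  case (Cons p H)
  then show ?case
    by (cases p; cases "a = fst p") auto
qed simp

lemma length_last_labels: "length (last_labels D H) = card (fst ` set H - D)"
proof (induction D H rule: last_labels.induct)
  case (2 D a k H)
  show ?case
  proof (cases "a \<in> D")
    case False
    have "insert a (fst ` set H) - D = insert a (fst ` set H - insert a D)"
      using False by auto
    then show ?thesis
      using 2 False by simp
  qed (use 2 in \<open>auto simp: insert_Diff_if\<close>)
qed auto

text \<open>Every index that occurs belongs to an address outside \<open>D\<close>. As the address
  of the head enters \<open>D\<close> for the tail, this separates the indices of head and
  tail.\<close>

lemma set_indices_last_labels:
  "set (indices (last_labels D H)) \<subseteq>
     {k. \<exists>a. a \<notin> D \<and> (a, k) \<in> set H} \<union> Inl ` (fst ` set H - D)"
proof (induction D H rule: last_labels.induct)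
  case (2 D a k H)
  show ?case
  proof (cases "a \<in> D")
    case False
    show ?thesis
    proof
      fix x assume "x \<in> set (indices (last_labels D ((a, k) # H)))"
      then consider "x = current Inl H a" | "x = k" | "x \<in> set (indices (last_labels (insert a D) H))"
        using False by auto
      then show "x \<in> {k'. \<exists>a'. a' \<notin> D \<and> (a', k') \<in> set ((a, k) # H)} \<union> Inl ` (fst ` set ((a, k) # H) - D)"
      proof cases
        case 1
        then show ?thesis
          using current_cases[of Inl H a] False by auto
      next
        case 3
        then show ?thesis
          using 2(2)[OF False] by auto
      qed (use False in auto)
    qed
  qed (use 2 in auto)
qed auto

lemma distinct_indices_last_labels:
  assumes "distinct (map snd H)" "snd ` set H \<subseteq> range Inr"
  shows "distinct (indices (last_labels D H))"
  using assms
proof (induction D H rule: last_labels.induct)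
  case (2 D a k H)
  show ?case
  proof (cases "a \<in> D")
    case False
    have sub: "set (indices (last_labels (insert a D) H)) \<subseteq>
        {k. \<exists>a'. a' \<notin> insert a D \<and> (a', k) \<in> set H} \<union> Inl ` (fst ` set H - insert a D)"
      by (rule set_indices_last_labels)
    have k: "k \<notin> snd ` set H" "k \<in> range Inr"
      using 2 by auto
    then have 1: "k \<notin> set (indices (last_labels (insert a D) H))"
      using sub by (force simp: image_iff)
    have uniq: "a1 = a2" if "(a1, k') \<in> set H" "(a2, k') \<in> set H" for a1 a2 k'
    proof -
      have "inj_on snd (set H)"
        using 2(3) by (simp add: distinct_map)
      from inj_onD[OF this, of "(a1, k')" "(a2, k')"] that show ?thesis
        by simp
    qed
    have inr: "k' \<notin> range Inl" if "(a', k') \<in> set H" for a' k'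
      using that 2(4) by force
    have 3: "current Inl H a \<notin> set (indices (last_labels (insert a D) H))"
    proof
      assume "current Inl H a \<in> set (indices (last_labels (insert a D) H))"
      then consider a' where "a' \<noteq> a" "(a', current Inl H a) \<in> set H" | a' where "a' \<noteq> a" "current Inl H a = Inl a'"
        using sub by blast
      then show False
      proof cases
        case (1 a')
        then show False
          using current_cases[of Inl H a] uniq inr by (metis rangeI)
      next
        case (2 a')
        then show False
          using current_cases[of Inl H a] inr by (metis Inl_inject rangeI)
      qed
    qed
    have 4: "current Inl H a \<noteq> k"
      using k current_cases[of Inl H a] by force
    show ?thesis
      using False 1 3 4 2 by simp
  qed (use 2 in auto)
qed auto

text \<open>\<open>K\<close> collects the leaves read by more recent accesses, and \<open>D\<close>
  the addresses of these accesses. Every class missing from \<open>A\<close> has been hit by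
  \<open>K\<close>, but not conversely: an access to an address in \<open>D\<close> enlarges
  \<open>K\<close> and leaves \<open>A\<close> alone, as its labels do not occur in
  \<open>last_labels\<close>.\<close>

lemma card_unmarked_le_survivors:
  fixes w :: "nat + 'k \<Rightarrow> 'l" and ex :: "'l \<Rightarrow> 'c"
  assumes "X - A \<subseteq> ex ` K" "\<And>k. k \<in> snd ` set H \<Longrightarrow> ex (w k) \<in> X \<union> B"
  defines "cur \<equiv> \<lambda>H. current (w \<circ> Inl) (map (apsnd w) H)"
  defines "rd \<equiv> \<lambda>H. reads_since (w \<circ> Inl) (map (apsnd w) H)"
  shows "card {a \<in> fst ` set H - D. \<forall>x\<in>K \<union> rd H a. ex (cur H a) \<in> B \<or> ex x \<noteq> ex (cur H a)}
    \<le> survivors ex B A (last_labels D H) w"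
  using assms(1,2)
proof (induction H arbitrary: D K A)
  case (Cons p H)
  obtain a k where p [simp]: "p = (a, k)"
    by (cases p)
  define x where "x = cur H a"
  let ?Q = "\<lambda>K H a. \<forall>x\<in>K \<union> rd H a. ex (cur H a) \<in> B \<or> ex x \<noteq> ex (cur H a)"
  let ?S = "{a' \<in> fst ` set (p # H) - D. ?Q K (p # H) a'}"
  have cur: "cur ((a, k) # H) a' = (if a' = a then w k else cur H a')"
    and rd: "rd ((a, k) # H) a' = insert x (if a' = a then {} else rd H a')" for a'
    by (simp_all add: cur_def rd_def x_def)
  have x: "x = w (current Inl H a)"
    by (simp add: x_def cur_def current_map)
  show ?case
  proof (cases "a \<in> D")
    case True
    have "?S \<subseteq> {a' \<in> fst ` set H - D. ?Q (insert x K) H a'}"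
      using True by (auto simp: cur rd split: if_splits)
    then have "card ?S \<le> card {a' \<in> fst ` set H - D. ?Q (insert x K) H a'}"
      by (intro card_mono) auto
    also have "\<dots> \<le> survivors ex B A (last_labels D H) w"
      using Cons.prems by (intro Cons.IH) auto
    finally show ?thesis
      using True by simp
  next
    case False
    let ?S' = "{a' \<in> fst ` set H - insert a D. ?Q (insert x K) H a'}"
    let ?c = "ex (w k) \<in> (A - {ex x}) \<union> B"
    have "?S \<subseteq> (if ?c then {a} else {}) \<union> ?S'"
    proof
      fix a' assume a': "a' \<in> ?S"
      show "a' \<in> (if ?c then {a} else {}) \<union> ?S'"
      proof (cases "a' = a")
        case True
        then have "ex (w k) \<in> B \<or> (ex (w k) \<notin> ex ` K \<and> ex (w k) \<noteq> ex x)"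
          using a' by (auto simp: cur rd)
        moreover have "ex (w k) \<in> X \<union> B"
          using Cons.prems(2)[of k] by simp
        ultimately have ?c
          using Cons.prems(1) by blast
        then show ?thesis
          using True by simp
      next
        case neq: False
        then show ?thesis
          using a' by (auto simp: cur rd)
      qed
    qed
    then have "card ?S \<le> card ((if ?c then {a} else {}) \<union> ?S')"
      by (intro card_mono) auto
    also have "\<dots> \<le> card (if ?c then {a} else {}) + card ?S'"
      by (rule card_Un_le)
    also have "\<dots> \<le> (if ?c then 1 else 0) + card ?S'"
      by simp
    also have "card ?S' \<le> survivors ex B (A - {ex x}) (last_labels (insert a D) H) w"
      using Cons.prems by (intro Cons.IH) auto
    finally show ?thesis
      using False x by simp
  qed
qed auto

text \<open>With unbounded buckets these blocks would still lie in \<open>T\<close>: a path that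
  shares a node outside \<open>T\<close> with the path of the block leaves \<open>T\<close> through
  the same exit. A block whose path ends in a leaf of \<open>T\<close> cannot leave \<open>T\<close>
  at all.\<close>

definition unevicted :: "nat \<Rightarrow> (nat \<times> nat) set \<Rightarrow> (nat \<Rightarrow> nat) \<Rightarrow> (nat \<times> nat) list \<Rightarrow> nat set" where
  "unevicted L T f H = {a \<in> fst ` set H. \<forall>x\<in>reads_since f H a.
     exit_node L T (current f H a) \<in> virtual_exits L \<or> exit_node L T x \<noteq> exit_node L T (current f H a)}"

lemma prob_unevicted:
  fixes H :: "(nat \<times> (nat + 'k)) list"
  assumes "finite I" "fst ` set H \<subseteq> {..<n}" "n \<le> 2 ^ L" "Inl ` {..<n} \<subseteq> I" "snd ` set H \<subseteq> I"
    and "distinct (map snd H)" "snd ` set H \<subseteq> range Inr"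
  shows "measure_pmf.prob (Pi_pmf I d (\<lambda>_. pmf_of_set {..<2 ^ L}))
      {w. \<exists>T\<in>top_subtrees L. R + 5 * card T \<le> card (unevicted L T (w \<circ> Inl) (map (apsnd w) H))}
    \<le> 6 * (3/5) ^ R" (is "measure_pmf.prob ?P ?E \<le> _")
proof -
  define js where "js = last_labels {} H"
  let ?F = "{w. \<exists>T\<in>top_subtrees L. R + 5 * card T \<le> survivors (exit_node L T) (virtual_exits L) (exits L T) js w}"
  have len: "length js \<le> 2 ^ L"
    using assms(2,3) card_mono[OF _ assms(2)] by (simp add: js_def length_last_labels)
  have sub: "set (indices js) \<subseteq> I"
  proof
    fix k assume "k \<in> set (indices js)"
    then consider a where "(a, k) \<in> set H" | "k \<in> Inl ` fst ` set H"
      using set_indices_last_labels[of "{}" H] unfolding js_def by blast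
    then show "k \<in> I"
      using assms(2,4,5) by cases (force, blast)
  qed
  \<comment> \<open>The events are compared on the support, where all labels are below
    \<open>2 ^ L\<close> and \<open>exit_node_in\<close> applies.\<close>
  have EF: "w \<in> ?F" if w: "w \<in> set_pmf ?P" and E: "w \<in> ?E" for w
  proof -
    have lt: "w k < 2 ^ L" if "k \<in> I" for k
    proof -
      have "w \<in> PiE_dflt I d (set_pmf \<circ> (\<lambda>_. pmf_of_set {..<2 ^ L}))"
        using w set_Pi_pmf_subset'[OF assms(1), of d "\<lambda>_. pmf_of_set {..<2 ^ L}"] by blast
      then show ?thesis
        using that by (simp add: PiE_dflt_def lessThan_empty_iff)
    qed
    from E obtain T where T: "T \<in> top_subtrees L"
      "R + 5 * card T \<le> card (unevicted L T (w \<circ> Inl) (map (apsnd w) H))"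
      by auto
    have eq: "unevicted L T (w \<circ> Inl) (map (apsnd w) H) =
        {a \<in> fst ` set H - {}. \<forall>x\<in>{} \<union> reads_since (w \<circ> Inl) (map (apsnd w) H) a.
           exit_node L T (current (w \<circ> Inl) (map (apsnd w) H) a) \<in> virtual_exits L \<or>
           exit_node L T x \<noteq> exit_node L T (current (w \<circ> Inl) (map (apsnd w) H) a)}"
      by (simp add: unevicted_def image_image)
    have "card (unevicted L T (w \<circ> Inl) (map (apsnd w) H))
        \<le> survivors (exit_node L T) (virtual_exits L) (exits L T) js w"
      unfolding js_def eq
    proof (rule card_unmarked_le_survivors)
      show "exit_node L T (w k) \<in> exits L T \<union> virtual_exits L" if "k \<in> snd ` set H" for k
        using that assms(5) by (intro exit_node_in T lt) auto
    qed simp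
    with T have "R + 5 * card T \<le> survivors (exit_node L T) (virtual_exits L) (exits L T) js w"
      by linarith
    with T(1) show ?thesis
      by (intro CollectI bexI)
  qed
  have "AE w in ?P. w \<in> ?E \<longrightarrow> w \<in> ?F"
    unfolding AE_measure_pmf_iff by (intro ballI impI EF)
  then have "measure_pmf.prob ?P ?E \<le> measure_pmf.prob ?P ?F"
    by (rule measure_pmf.finite_measure_mono_AE) simp
  also have "\<dots> \<le> 6 * (3/5) ^ R"
    using assms(1) distinct_indices_last_labels[OF assms(6,7)] sub len
    unfolding js_def by (rule prob_subtree_overfull)
  finally show ?thesis .
qed

section \<open>A single ORAM\<close>

lemma real_blocks_padded [simp]: "finite M \<Longrightarrow> real_blocks (padded M) = M"
  by (auto simp: real_blocks_def padded_def)

lemma size_padded [simp]: "card M \<le> bucket_size \<Longrightarrow> size (padded M) = bucket_size"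
  by (simp add: padded_def)

lemma finite_real_blocks [simp]: "finite (real_blocks K)"
proof -
  have "real_blocks K = Some -` set_mset K"
    by (auto simp: real_blocks_def)
  then show ?thesis
    by (simp add: finite_vimageI)
qed

definition is_full :: "'v bucket \<Rightarrow> bool" where
  "is_full K \<longleftrightarrow> card (real_blocks K) = bucket_size"

definition stored :: "'v oram \<Rightarrow> 'v block set" where
  "stored R = stash R \<union> (\<Union>v. real_blocks (tree R v))"

text \<open>The buckets shared by both paths from level \<open>d\<close> on have no room. This
  excuses a block with label \<open>y\<close> for not having followed the path to \<open>x\<close>
  to level \<open>d\<close> or deeper.\<close>

definition full_from :: "nat \<Rightarrow> 'v oram \<Rightarrow> nat \<Rightarrow> nat \<Rightarrow> nat \<Rightarrow> bool" where
  "full_from L R d x y \<longleftrightarrow> (\<forall>l. d \<le> l \<and> l \<le> L \<and> path_node L x l = path_node L y l \<longrightarrow>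
     is_full (tree R (path_node L y l)))"

text \<open>
  In an ORAM with unbounded buckets, a block would lie at the deepest level that its path shares
  with one of the paths read since its last access. The last two clauses say that between the
  actual position of the block and this level all buckets are full.
\<close>

definition oram_inv :: "nat \<Rightarrow> (nat \<Rightarrow> nat) \<Rightarrow> (nat \<times> nat) list \<Rightarrow> 'v oram \<Rightarrow> bool" where
  "oram_inv L f H R \<longleftrightarrow>
     finite (stash R) \<and>
     (\<forall>v. size (tree R v) = bucket_size) \<and>
     inj_on addr (stored R) \<and>
     addr ` stored R = fst ` set H \<and>
     (\<forall>b\<in>stored R. label b = current f H (addr b)) \<and>
     (\<forall>v. stash R \<inter> real_blocks (tree R v) = {}) \<and>
     (\<forall>v v'. v \<noteq> v' \<longrightarrow> real_blocks (tree R v) \<inter> real_blocks (tree R v') = {}) \<and>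
     (\<forall>v. \<forall>b\<in>real_blocks (tree R v). fst v \<le> L \<and> path_node L (label b) (fst v) = v) \<and>
     (\<forall>b\<in>stash R. \<forall>x\<in>reads_since f H (addr b). full_from L R 0 x (label b)) \<and>
     (\<forall>v. \<forall>b\<in>real_blocks (tree R v). \<forall>x\<in>reads_since f H (addr b).
        full_from L R (Suc (fst v)) x (label b))"

lemma oram_invD:
  assumes "oram_inv L f H R"
  shows "finite (stash R)"
    and "size (tree R v) = bucket_size"
    and "inj_on addr (stored R)"
    and "addr ` stored R = fst ` set H"
    and "b \<in> stored R \<Longrightarrow> label b = current f H (addr b)"
    and "stash R \<inter> real_blocks (tree R v) = {}"
    and "v \<noteq> v' \<Longrightarrow> real_blocks (tree R v) \<inter> real_blocks (tree R v') = {}"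
    and "b \<in> real_blocks (tree R v) \<Longrightarrow> fst v \<le> L \<and> path_node L (label b) (fst v) = v"
    and "b \<in> stash R \<Longrightarrow> x \<in> reads_since f H (addr b) \<Longrightarrow> full_from L R 0 x (label b)"
    and "b \<in> real_blocks (tree R v) \<Longrightarrow> x \<in> reads_since f H (addr b) \<Longrightarrow>
       full_from L R (Suc (fst v)) x (label b)"
proof -
  note inv = assms[unfolded oram_inv_def]
  show "finite (stash R)"
    by (rule inv[THEN conjunct1, rule_format])
  show "size (tree R v) = bucket_size"
    by (rule inv[THEN conjunct2, THEN conjunct1, rule_format])
  show "inj_on addr (stored R)"
    by (rule inv[THEN conjunct2, THEN conjunct2, THEN conjunct1, rule_format])
  show "addr ` stored R = fst ` set H"
    by (rule inv[THEN conjunct2, THEN conjunct2, THEN conjunct2, THEN conjunct1, rule_format])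
  show "b \<in> stored R \<Longrightarrow> label b = current f H (addr b)"
    by (rule inv[THEN conjunct2, THEN conjunct2, THEN conjunct2, THEN conjunct2, THEN conjunct1, rule_format])
  show "stash R \<inter> real_blocks (tree R v) = {}"
    by (rule inv[THEN conjunct2, THEN conjunct2, THEN conjunct2, THEN conjunct2, THEN conjunct2, THEN conjunct1, rule_format])
  show "v \<noteq> v' \<Longrightarrow> real_blocks (tree R v) \<inter> real_blocks (tree R v') = {}"
    by (rule inv[THEN conjunct2, THEN conjunct2, THEN conjunct2, THEN conjunct2, THEN conjunct2, THEN conjunct2, THEN conjunct1, rule_format])
  show "b \<in> real_blocks (tree R v) \<Longrightarrow> fst v \<le> L \<and> path_node L (label b) (fst v) = v"
    by (rule inv[THEN conjunct2, THEN conjunct2, THEN conjunct2, THEN conjunct2, THEN conjunct2, THEN conjunct2, THEN conjunct2, THEN conjunct1, rule_format])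
  show "b \<in> stash R \<Longrightarrow> x \<in> reads_since f H (addr b) \<Longrightarrow> full_from L R 0 x (label b)"
    by (rule inv[THEN conjunct2, THEN conjunct2, THEN conjunct2, THEN conjunct2, THEN conjunct2, THEN conjunct2, THEN conjunct2, THEN conjunct2, THEN conjunct1, rule_format])
  show "b \<in> real_blocks (tree R v) \<Longrightarrow> x \<in> reads_since f H (addr b) \<Longrightarrow>
       full_from L R (Suc (fst v)) x (label b)"
    by (rule inv[THEN conjunct2, THEN conjunct2, THEN conjunct2, THEN conjunct2, THEN conjunct2, THEN conjunct2, THEN conjunct2, THEN conjunct2, THEN conjunct2, rule_format])
qed

lemma oram_inv_empty: "oram_inv L f [] empty_oram"
  by (simp add: oram_inv_def empty_oram_def stored_def)

text \<open>\<open>M l\<close> is the set of blocks that are moved from \<open>S\<close> into the bucket at level \<open>l \<ge> m\<close>.\<close>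

definition evicted :: "nat \<Rightarrow> nat \<Rightarrow> nat \<Rightarrow> 'v oram \<Rightarrow> 'v oram \<Rightarrow> (nat \<Rightarrow> 'v block set) \<Rightarrow> bool" where
  "evicted L x m R R' M \<longleftrightarrow>
     (\<forall>l\<in>{m..L}. M l \<subseteq> stash R \<and> card (M l) \<le> bucket_size \<and>
        (\<forall>b\<in>M l. path_node L (label b) l = path_node L x l)) \<and>
     (\<forall>l\<in>{m..L}. \<forall>l'\<in>{m..L}. l \<noteq> l' \<longrightarrow> M l \<inter> M l' = {}) \<and>
     stash R' = stash R - (\<Union>l\<in>{m..L}. M l) \<and>
     (\<forall>v. tree R' v = (if m \<le> fst v \<and> fst v \<le> L \<and> v = path_node L x (fst v)
        then padded (M (fst v)) else tree R v)) \<and>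
     (\<forall>l\<in>{m..L}. \<forall>b\<in>stash R - (\<Union>l'\<in>{l..L}. M l').
        path_node L (label b) l = path_node L x l \<longrightarrow> card (M l) = bucket_size)"

text \<open>Buckets are filled from the leaf upwards, so the induction runs downwards in
  \<open>m\<close>. The last clause of \<open>evicted\<close> comes from the maximality of a valid
  policy: it takes all eligible blocks or fills the bucket, so a block left behind proves the bucket
  full.\<close>

lemma evicted_fold:
  assumes "valid_policy pick" "finite (stash R)" "m \<le> Suc L"
  shows "\<exists>M. evicted L x m R (fold (evict pick i L x) (rev [m..<Suc L]) R) M"
  using assms(3)
proof (induction rule: inc_induct)
  case base
  then show ?case
    by (auto simp: evicted_def)
next
  case (step m)
  let ?R = "fold (evict pick i L x) (rev [Suc m..<Suc L]) R"
  define S where "S = stash R"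
  from step.IH obtain M where "evicted L x (Suc m) R ?R M" ..
  note M = this[unfolded evicted_def, folded S_def, THEN conjunct1, rule_format]
    this[unfolded evicted_def, folded S_def, THEN conjunct2, THEN conjunct1, rule_format]
    this[unfolded evicted_def, folded S_def, THEN conjunct2, THEN conjunct2, THEN conjunct1]
    this[unfolded evicted_def, folded S_def, THEN conjunct2, THEN conjunct2, THEN conjunct2, THEN conjunct1, rule_format]
    this[unfolded evicted_def, folded S_def, THEN conjunct2, THEN conjunct2, THEN conjunct2, THEN conjunct2, rule_format]
  have finS: "finite S"
    using assms(2) by (simp add: S_def)
  define E where "E = {b \<in> stash ?R. path_node L (label b) m = path_node L x m}"
  define P where "P = pick i ?R x m E"
  have finE: "finite E"
    using finS M(3) by (simp add: E_def)
  have P: "P \<subseteq> E" "card P = min (card E) bucket_size"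
    using assms(1) finE unfolding valid_policy_def P_def by auto
  define M' where "M' = M(m := P)"
  have M'm: "M' m = P"
    by (simp add: M'_def)
  have M'l: "M' l = M l" if "l \<noteq> m" for l
    using that by (simp add: M'_def)
  have "m < Suc L"
    using step by simp
  then have "rev [m..<Suc L] = rev [Suc m..<Suc L] @ [m]"
    by (simp add: upt_conv_Cons)
  then have fold: "fold (evict pick i L x) (rev [m..<Suc L]) R =
      ?R\<lparr>tree := (tree ?R)(path_node L x m := padded P), stash := stash ?R - P\<rparr>"
    by (simp add: evict_def Let_def E_def P_def)
  have ivl: "{m..L} = insert m {Suc m..L}"
    using \<open>m < Suc L\<close> by auto
  have un: "(\<Union>l\<in>{l0..L}. M' l) = (\<Union>l\<in>{l0..L}. M l)" if "Suc m \<le> l0" for l0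
    using that by (intro SUP_cong refl M'l) auto
  have unm: "(\<Union>l\<in>{m..L}. M' l) = P \<union> (\<Union>l\<in>{Suc m..L}. M l)"
    unfolding ivl using un[of "Suc m"] M'm by auto
  have PS: "P \<subseteq> S" "P \<inter> (\<Union>l\<in>{Suc m..L}. M l) = {}" "\<And>b. b \<in> P \<Longrightarrow> path_node L (label b) m = path_node L x m"
    using P(1) M(3) by (auto simp: E_def)
  show ?case
    unfolding evicted_def S_def[symmetric]
  proof (rule exI[of _ M'], intro conjI)
    show "\<forall>l\<in>{m..L}. M' l \<subseteq> S \<and> card (M' l) \<le> bucket_size \<and>
        (\<forall>b\<in>M' l. path_node L (label b) l = path_node L x l)"
    proof
      fix l assume l: "l \<in> {m..L}"
      show "M' l \<subseteq> S \<and> card (M' l) \<le> bucket_size \<and>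
          (\<forall>b\<in>M' l. path_node L (label b) l = path_node L x l)"
      proof (cases "l = m")
        case True
        then show ?thesis
          using PS P(2) M'm by simp
      next
        case False
        then show ?thesis
          using M(1)[of l] M'l[OF False] l by simp
      qed
    qed
    show "\<forall>l\<in>{m..L}. \<forall>l'\<in>{m..L}. l \<noteq> l' \<longrightarrow> M' l \<inter> M' l' = {}"
    proof (intro ballI impI)
      fix l l' assume l: "l \<in> {m..L}" "l' \<in> {m..L}" "l \<noteq> l'"
      consider "l = m" "l' \<in> {Suc m..L}" | "l' = m" "l \<in> {Suc m..L}" | "l \<in> {Suc m..L}" "l' \<in> {Suc m..L}"
        using l by fastforce
      then show "M' l \<inter> M' l' = {}"
      proof cases
        case 1
        then have "M' l = P" "M' l' = M l'"
          by (auto simp: M'_def)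
        then show ?thesis
          using PS(2) 1 by blast
      next
        case 2
        then have "M' l' = P" "M' l = M l"
          by (auto simp: M'_def)
        then show ?thesis
          using PS(2) 2 by blast
      next
        case 3
        then have "M' l = M l" "M' l' = M l'"
          by (auto simp: M'_def)
        then show ?thesis
          using M(2)[OF 3 l(3)] by simp
      qed
    qed
    show "stash (fold (evict pick i L x) (rev [m..<Suc L]) R) = S - (\<Union>l\<in>{m..L}. M' l)"
      unfolding fold unm using M(3) by auto
    show "\<forall>v. tree (fold (evict pick i L x) (rev [m..<Suc L]) R) v =
        (if m \<le> fst v \<and> fst v \<le> L \<and> v = path_node L x (fst v) then padded (M' (fst v)) else tree R v)"
    proof
      fix v
      show "tree (fold (evict pick i L x) (rev [m..<Suc L]) R) v =
          (if m \<le> fst v \<and> fst v \<le> L \<and> v = path_node L x (fst v) then padded (M' (fst v)) else tree R v)"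
      proof (cases "v = path_node L x m")
        case True
        then show ?thesis
          unfolding fold using \<open>m < Suc L\<close> M'm by simp
      next
        case False
        then have "fst v \<noteq> m" if "v = path_node L x (fst v)"
          using that by metis
        then have "m \<le> fst v \<and> fst v \<le> L \<and> v = path_node L x (fst v) \<longleftrightarrow>
            Suc m \<le> fst v \<and> fst v \<le> L \<and> v = path_node L x (fst v)"
          by (cases "v = path_node L x (fst v)") auto
        moreover have "M' (fst v) = M (fst v)" if "Suc m \<le> fst v"
          using that by (intro M'l) simp
        ultimately show ?thesis
          unfolding fold using M(4)[of v] False by simp
      qed
    qed
    show "\<forall>l\<in>{m..L}. \<forall>b\<in>S - (\<Union>l'\<in>{l..L}. M' l').
        path_node L (label b) l = path_node L x l \<longrightarrow> card (M' l) = bucket_size"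
    proof (intro ballI impI)
      fix l b assume l: "l \<in> {m..L}" and b: "b \<in> S - (\<Union>l'\<in>{l..L}. M' l')"
        "path_node L (label b) l = path_node L x l"
      show "card (M' l) = bucket_size"
      proof (cases "l = m")
        case True
        have "b \<in> E" "b \<notin> P"
          using b M(3) unfolding True unm E_def by auto
        then have "P \<subset> E"
          using P(1) by blast
        then have "card P < card E"
          using finE by (rule psubset_card_mono[rotated])
        then show ?thesis
          using P(2) True M'm by simp
      next
        case False
        then have "Suc m \<le> l"
          using l by simp
        then show ?thesis
          using M(5)[of l b] b l un[of l] M'l[OF False] by simp
      qed
    qed
  qed
qed

text \<open>The memory that tree and stash represent together. It lets reads and writes of
  position-map blocks be stated independently of where a block lies.\<close>

definition lookup :: "'v oram \<Rightarrow> nat \<Rightarrow> 'v content \<Rightarrow> 'v content" where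
  "lookup R a c0 = (if \<exists>b\<in>stored R. addr b = a
     then content (THE b. b \<in> stored R \<and> addr b = a) else c0)"

lemma lookup_eq:
  assumes "inj_on addr (stored R)" "b \<in> stored R"
  shows "lookup R (addr b) c0 = content b"
proof -
  have "(THE b'. b' \<in> stored R \<and> addr b' = addr b) = b"
    using assms by (auto simp: inj_on_def)
  then show ?thesis
    using assms(2) by (auto simp: lookup_def)
qed

lemma lookup_absent: "a \<notin> addr ` stored R \<Longrightarrow> lookup R a c0 = c0"
  by (auto simp: lookup_def)

lemma blocks_transferred_const:
  assumes "\<And>K. K \<in> set Ks \<Longrightarrow> size K = s"
  shows "blocks_transferred Ks = length Ks * s"
  using assms by (induction Ks) (auto simp: blocks_transferred_def)

text \<open>Fullness survives for two reasons. On the path just read, a block that ends up higher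
  than it could was eligible for the buckets in between and left behind, so they are full. A bucket
  off this path is unchanged, and where it lies on the path of a block it is covered by the old
  invariant, being deeper than the old position of the block whenever that block has been
  read.\<close>

lemma access_inv:
  fixes R :: "'v oram"
  assumes inv: "oram_inv L f H R" and pick: "valid_policy pick" and x: "x = current f H a"
    and acc: "access pick i L c0 a x y upd R = (c, R', T)"
  shows "oram_inv L f ((a, y) # H) R'"
    and "c = lookup R a c0"
    and "lookup R' a c1 = upd c"
    and "a' \<noteq> a \<Longrightarrow> lookup R' a' c1 = lookup R a' c1"
    and "blocks_transferred T = 2 * Suc L * bucket_size"
proof -
  define S where "S = stash R \<union> (\<Union>K\<in>set (map (tree R) (path_nodes L x)). real_blocks K)"
  define nb where "nb = Block a y (upd c)"
  define S' where "S' = insert nb {b \<in> S. addr b \<noteq> a}"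
  note acc' = acc[symmetric, unfolded access_def Let_def prod.inject, folded S_def]
  have c: "c = (if \<exists>b\<in>S. addr b = a then content (THE b. b \<in> S \<and> addr b = a) else c0)"
    by (rule acc'[THEN conjunct1])
  have R': "R' = fold (evict pick i L x) (rev [0..<Suc L]) (R\<lparr>stash := S'\<rparr>)"
    unfolding S'_def nb_def by (rule acc'[folded c, THEN conjunct2, THEN conjunct1])
  have T: "T = map (tree R) (path_nodes L x) @ map (tree R') (path_nodes L x)"
    unfolding R' S'_def nb_def by (rule acc'[folded c, THEN conjunct2, THEN conjunct2])
  note fin = oram_invD(1)[OF inv]
    and size = oram_invD(2)[OF inv]
    and inj = oram_invD(3)[OF inv]
    and addrs = oram_invD(4)[OF inv]
    and labs = oram_invD(5)[OF inv]
    and disj = oram_invD(6,7)[OF inv]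
    and loc = oram_invD(8)[OF inv]
    and full_stash = oram_invD(9)[OF inv]
    and full_tree = oram_invD(10)[OF inv]
  define onp where "onp v \<longleftrightarrow> fst v \<le> L \<and> v = path_node L x (fst v)" for v
  have onp_path: "onp (path_node L x l)" if "l \<le> L" for l
    using that by (simp add: onp_def)
  have "set (path_nodes L x) = Collect onp"
  proof -
    have "v \<in> set (path_nodes L x) \<longleftrightarrow> onp v" for v
    proof
      assume "onp v"
      then have "v = path_node L x (fst v)" "fst v \<in> set [0..<Suc L]"
        by (auto simp: onp_def)
      then show "v \<in> set (path_nodes L x)"
        unfolding path_nodes_def by (metis image_eqI set_map)
    qed (auto simp: path_nodes_def onp_def)
    then show ?thesis
      by auto
  qed
  then have S: "S = stash R \<union> (\<Union>v\<in>Collect onp. real_blocks (tree R v))"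
    by (simp add: S_def)
  have stored_split: "stored R = S \<union> (\<Union>v\<in>- Collect onp. real_blocks (tree R v))"
    unfolding S stored_def by blast
  have off_disj: "b \<notin> S" if "b \<in> real_blocks (tree R v)" "\<not> onp v" for b v
  proof
    assume "b \<in> S"
    then consider "b \<in> stash R" | v' where "onp v'" "b \<in> real_blocks (tree R v')"
      unfolding S by blast
    then show False
    proof cases
      case 1
      then show False
        using disj(1)[of v] that by blast
    next
      case (2 v')
      then have "v \<noteq> v'"
        using that by blast
      then show False
        using disj(2)[of v v'] 2 that by blast
    qed
  qed
  have in_stored: "b \<in> stored R" if "b \<in> real_blocks (tree R v)" for b v
    using that unfolding stored_def by blast
  have S_stored: "S \<subseteq> stored R"
    using stored_split by blast
  \<comment> \<open>The invariant keeps block \<open>a\<close> in the stash or on the path to its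
    current label \<open>x\<close>, so replacing it in \<open>S\<close> leaves no stale copy in the
    tree.\<close>
  have a_on_path: "onp v" if "b \<in> real_blocks (tree R v)" "addr b = a" for b v
    using loc[OF that(1)] labs[OF in_stored[OF that(1)]] that(2) x by (simp add: onp_def)
  have finS: "finite S"
    unfolding S_def using fin by auto
  then have finS': "finite S'"
    by (simp add: S'_def)
  have "finite (stash (R\<lparr>stash := S'\<rparr>))"
    using finS' by simp
  from evicted_fold[OF pick this, of 0 L x i]
  obtain M where "evicted L x 0 (R\<lparr>stash := S'\<rparr>) (fold (evict pick i L x) (rev [0..<Suc L]) (R\<lparr>stash := S'\<rparr>)) M"
    by blast
  then have ev: "evicted L x 0 (R\<lparr>stash := S'\<rparr>) R' M"
    by (simp only: R')
  have stash_upd: "stash (R\<lparr>stash := S'\<rparr>) = S'"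
    by simp
  note ev' = ev[unfolded evicted_def stash_upd]
  have M: "M l \<subseteq> S'" "card (M l) \<le> bucket_size"
    "b \<in> M l \<Longrightarrow> path_node L (label b) l = path_node L x l" if "l \<le> L" for l b
    using ev'[THEN conjunct1, rule_format, of l] that by simp_all
  have M_disj: "M l \<inter> M l' = {}" if "l \<le> L" "l' \<le> L" "l \<noteq> l'" for l l'
    using ev'[THEN conjunct2, THEN conjunct1, rule_format, of l l'] that by simp
  have M_stash: "stash R' = S' - (\<Union>l\<in>{0..L}. M l)"
    by (rule ev'[THEN conjunct2, THEN conjunct2, THEN conjunct1])
  have M_tree: "tree R' v = (if 0 \<le> fst v \<and> fst v \<le> L \<and> v = path_node L x (fst v)
       then padded (M (fst v)) else tree (R\<lparr>stash := S'\<rparr>) v)" for v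
    by (rule ev'[THEN conjunct2, THEN conjunct2, THEN conjunct2, THEN conjunct1, rule_format])
  have M_full: "card (M l) = bucket_size"
    if "l \<le> L" "b \<in> S' - (\<Union>l'\<in>{l..L}. M l')" "path_node L (label b) l = path_node L x l" for l b
    using ev'[THEN conjunct2, THEN conjunct2, THEN conjunct2, THEN conjunct2, rule_format, of l b] that
    by simp
  have tree: "tree R' v = (if onp v then padded (M (fst v)) else tree R v)" for v
    using M_tree[of v] by (simp add: onp_def)
  have finM: "finite (M l)" if "l \<le> L" for l
    using M(1)[OF that] finS' by (rule finite_subset)
  have rb_on: "real_blocks (tree R' v) = M (fst v)" if "onp v" for v
    using that finM by (simp add: tree onp_def)
  have rb_off: "real_blocks (tree R' v) = real_blocks (tree R v)" if "\<not> onp v" for v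
    using that by (simp add: tree)
  have off_addr: "addr b \<noteq> a" if "b \<in> real_blocks (tree R v)" "\<not> onp v" for b v
    using a_on_path that by blast
  have M_un: "(\<Union>v\<in>Collect onp. real_blocks (tree R' v)) = (\<Union>l\<in>{0..L}. M l)"
  proof -
    have "(\<Union>v\<in>Collect onp. real_blocks (tree R' v)) = (\<Union>v\<in>Collect onp. M (fst v))"
      using rb_on by auto
    also have "\<dots> = (\<Union>l\<in>fst ` Collect onp. M l)"
      by simp
    also have "fst ` Collect onp = {0..L}"
    proof
      show "{0..L} \<subseteq> fst ` Collect onp"
      proof
        fix l assume "l \<in> {0..L}"
        then show "l \<in> fst ` Collect onp"
          using onp_path[of l] by (intro image_eqI[of _ _ "path_node L x l"]) auto
      qed
    qed (auto simp: onp_def)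
    finally show ?thesis .
  qed
  have stored': "stored R' = insert nb {b \<in> stored R. addr b \<noteq> a}"
  proof -
    have "stored R' = stash R' \<union> (\<Union>v\<in>Collect onp. real_blocks (tree R' v)) \<union>
        (\<Union>v\<in>- Collect onp. real_blocks (tree R' v))"
      unfolding stored_def by blast
    also have "(\<Union>v\<in>- Collect onp. real_blocks (tree R' v)) = (\<Union>v\<in>- Collect onp. real_blocks (tree R v))"
      using rb_off by auto
    also have "stash R' \<union> (\<Union>v\<in>Collect onp. real_blocks (tree R' v)) = S'"
    proof -
      have "(\<Union>l\<in>{0..L}. M l) \<subseteq> S'"
        using M(1) by (intro UN_least) simp
      then show ?thesis
        unfolding M_un M_stash by blast
    qed
    also have "S' \<union> (\<Union>v\<in>- Collect onp. real_blocks (tree R v)) = insert nb {b \<in> stored R. addr b \<noteq> a}"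
    proof -
      have "addr b \<noteq> a" if "b \<in> (\<Union>v\<in>- Collect onp. real_blocks (tree R v))" for b
        using that off_addr by blast
      then show ?thesis
        unfolding S'_def stored_split by blast
    qed
    finally show ?thesis .
  qed
  have nb: "addr nb = a" "label nb = y" "content nb = upd c"
    by (simp_all add: nb_def)
  have inj': "inj_on addr (stored R')"
    unfolding stored'
  proof (rule inj_onI)
    fix b b' assume "b \<in> insert nb {b \<in> stored R. addr b \<noteq> a}" "b' \<in> insert nb {b \<in> stored R. addr b \<noteq> a}"
      "addr b = addr b'"
    then show "b = b'"
      using nb(1) inj_onD[OF inj, of b b'] by auto
  qed
  show "c = lookup R a c0"
  proof (cases "\<exists>b\<in>S. addr b = a")
    case True
    then obtain b where b: "b \<in> S" "addr b = a"
      by blast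
    then have "(THE b. b \<in> S \<and> addr b = a) = b"
      using inj_onD[OF inj] S_stored by (intro the_equality) auto
    then have "c = content b"
      using c True by simp
    then show ?thesis
      using lookup_eq[OF inj, of b c0] b S_stored by auto
  next
    case False
    then have "a \<notin> addr ` stored R"
      unfolding stored_split using off_addr by blast
    then show ?thesis
      using c False by (simp add: lookup_absent)
  qed
  show "lookup R' a c1 = upd c"
    using lookup_eq[OF inj', of nb c1] nb by (simp add: stored')
  show "lookup R' a' c1 = lookup R a' c1" if "a' \<noteq> a"
  proof (cases "a' \<in> addr ` stored R")
    case True
    then obtain b where b: "b \<in> stored R" "addr b = a'"
      by blast
    then have "b \<in> stored R'"
      using that by (simp add: stored')
    then show ?thesis
      using lookup_eq[OF inj', of b c1] lookup_eq[OF inj, of b c1] b by simp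
  next
    case False
    then have "a' \<notin> addr ` stored R'"
      using that nb by (auto simp: stored')
    then show ?thesis
      using False by (simp add: lookup_absent)
  qed
  have size': "size (tree R' v) = bucket_size" for v
    using M(2) size by (simp add: tree onp_def)
  show "blocks_transferred T = 2 * Suc L * bucket_size"
  proof -
    have "blocks_transferred T = length T * bucket_size"
      using size size' by (intro blocks_transferred_const) (auto simp: T)
    then show ?thesis
      by (simp add: T path_nodes_def)
  qed
  have M_mem: "b \<notin> (\<Union>l'\<in>{l..L}. M l')" if "b \<in> M l0" "l0 < l" "l0 \<le> L" for b l0 l
  proof
    assume "b \<in> (\<Union>l'\<in>{l..L}. M l')"
    then obtain l' where "l' \<in> {l..L}" "b \<in> M l'"
      by blast
    then show False
      using M_disj[of l0 l'] that by auto
  qed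
  have full_x: "is_full (tree R' (path_node L (label b) l))"
    if "b \<in> S' - (\<Union>l'\<in>{l..L}. M l')" "l \<le> L" "path_node L x l = path_node L (label b) l" for b l
    using M_full[OF that(2,1)] that(2,3) rb_on[OF onp_path[OF that(2)]]
    by (simp add: is_full_def)
  have full_S': "full_from L R' d z (label b)"
    if b: "b \<in> S'" and d: "\<And>l. d \<le> l \<Longrightarrow> b \<notin> (\<Union>l'\<in>{l..L}. M l')"
      and z: "z \<in> reads_since f ((a, y) # H) (addr b)" for b d z
    unfolding full_from_def
  proof (intro allI impI, elim conjE)
    fix l assume l: "d \<le> l" "l \<le> L" "path_node L z l = path_node L (label b) l"
    show "is_full (tree R' (path_node L (label b) l))"
    proof (cases "path_node L x l = path_node L (label b) l")
      case True
      then show ?thesis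
        using full_x b d l by blast
    next
      case False
      then have "z \<noteq> x"
        using l by auto
      \<comment> \<open>If \<open>addr b = a\<close>, the only read to consider is \<open>x\<close>
        itself; so \<open>b\<close> is an old block and \<open>z\<close> one of its earlier
        reads.\<close>
      then have z': "z \<in> reads_since f H (addr b)" "addr b \<noteq> a"
        using z x by (auto split: if_splits)
      then have bS: "b \<in> S"
        using b nb by (auto simp: S'_def)
      have "\<not> onp (path_node L (label b) l)"
        using False by (simp add: onp_def)
      moreover have "is_full (tree R (path_node L (label b) l))"
      proof -
        consider "b \<in> stash R" | v where "onp v" "b \<in> real_blocks (tree R v)"
          using bS unfolding S by blast
        then show ?thesis
        proof cases
          case 1
          then show ?thesis
            using full_stash[OF 1 z'(1)] l by (simp add: full_from_def)
        next
          case (2 v)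
          have v: "fst v \<le> L" "path_node L (label b) (fst v) = v" "v = path_node L x (fst v)"
            using loc[OF 2(2)] 2(1) by (auto simp: onp_def)
          \<comment> \<open>Down to its old bucket the path of \<open>b\<close> coincides with the
            path to \<open>x\<close>, so the two branch strictly below.\<close>
          have "Suc (fst v) \<le> l"
          proof (rule ccontr)
            assume "\<not> Suc (fst v) \<le> l"
            then have "l \<le> fst v"
              by simp
            moreover have "path_node L x (fst v) = path_node L (label b) (fst v)"
              using v(2,3) by metis
            ultimately have "path_node L x l = path_node L (label b) l"
              using v(1) path_node_agree_above by blast
            with False show False ..
          qed
          then show ?thesis
            using full_tree[OF 2(2) z'(1)] l by (simp add: full_from_def)
        qed
      qed
      ultimately show ?thesis
        by (simp add: tree)
    qed
  qed
  have full_off: "full_from L R' (Suc (fst v)) z (label b)"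
    if b: "b \<in> real_blocks (tree R v)" "\<not> onp v" and z: "z \<in> reads_since f ((a, y) # H) (addr b)" for b v z
    unfolding full_from_def
  proof (intro allI impI, elim conjE)
    fix l assume l: "Suc (fst v) \<le> l" "l \<le> L" "path_node L z l = path_node L (label b) l"
    have v: "fst v \<le> L" "path_node L (label b) (fst v) = v"
      using loc[OF b(1)] by auto
    \<comment> \<open>The bucket of \<open>b\<close> is not on the path to \<open>x\<close>, so the
      two paths have separated at or above level \<open>fst v\<close> and stay apart below.\<close>
    have neq: "path_node L x l \<noteq> path_node L (label b) l"
    proof
      assume "path_node L x l = path_node L (label b) l"
      then have "path_node L x (fst v) = path_node L (label b) (fst v)"
        by (rule path_node_agree_above) (use l in simp_all)
      then show False
        using v b(2) unfolding onp_def by metis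
    qed
    then have "z \<noteq> x"
      using l by auto
    then have "z \<in> reads_since f H (addr b)"
      using z x by (auto split: if_splits)
    then have "is_full (tree R (path_node L (label b) l))"
      using full_tree[OF b(1)] l by (simp add: full_from_def)
    then show "is_full (tree R' (path_node L (label b) l))"
      using neq by (simp add: tree onp_def)
  qed
  have M_off_disj: "b \<notin> S'" if "b \<in> real_blocks (tree R v)" "\<not> onp v" for b v
    using off_disj[OF that] off_addr[OF that] nb by (auto simp: S'_def)
  show "oram_inv L f ((a, y) # H) R'"
    unfolding oram_inv_def
  proof (intro conjI allI ballI impI)
    show "finite (stash R')"
      using finS' by (simp add: M_stash)
    show "size (tree R' v) = bucket_size" for v
      by (rule size')
    show "inj_on addr (stored R')"
      by (rule inj')
    show "addr ` stored R' = fst ` set ((a, y) # H)"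
    proof -
      have "addr ` {b \<in> stored R. addr b \<noteq> a} = addr ` stored R - {a}"
        by auto
      then show ?thesis
        using nb addrs by (simp add: stored')
    qed
    show "label b = current f ((a, y) # H) (addr b)" if "b \<in> stored R'" for b
      using that labs nb by (auto simp: stored')
    show "stash R' \<inter> real_blocks (tree R' v) = {}" for v
    proof (cases "onp v")
      case True
      then have "fst v \<in> {0..L}"
        by (simp add: onp_def)
      then show ?thesis
        unfolding M_stash rb_on[OF True] by blast
    next
      case False
      then show ?thesis
        unfolding M_stash rb_off[OF False] using M_off_disj[of _ v] by blast
    qed
    show "real_blocks (tree R' v) \<inter> real_blocks (tree R' v') = {}" if "v \<noteq> v'" for v v'
    proof (cases "onp v"; cases "onp v'")
      assume on: "onp v" "onp v'"
      then have "fst v \<noteq> fst v'"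
        using that unfolding onp_def by metis
      then show ?thesis
        using M_disj[of "fst v" "fst v'"] on rb_on by (simp add: onp_def)
    next
      assume on: "onp v" "\<not> onp v'"
      then have "M (fst v) \<subseteq> S'"
        using M(1) by (simp add: onp_def)
      then show ?thesis
        using M_off_disj[of _ v'] on rb_on[of v] rb_off[of v'] by blast
    next
      assume on: "\<not> onp v" "onp v'"
      then have "M (fst v') \<subseteq> S'"
        using M(1) by (simp add: onp_def)
      then show ?thesis
        using M_off_disj[of _ v] on rb_on[of v'] rb_off[of v] by blast
    next
      assume "\<not> onp v" "\<not> onp v'"
      then show ?thesis
        using disj(2)[OF that] rb_off by simp
    qed
    show "fst v \<le> L" "path_node L (label b) (fst v) = v" if "b \<in> real_blocks (tree R' v)" for v b
    proof -
      have "fst v \<le> L \<and> path_node L (label b) (fst v) = v"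
      proof (cases "onp v")
        case True
        then show ?thesis
          using M(3)[of "fst v" b] that rb_on[OF True] by (simp add: onp_def)
      next
        case False
        then show ?thesis
          using loc[of b v] that rb_off[OF False] by simp
      qed
      then show "fst v \<le> L" "path_node L (label b) (fst v) = v"
        by auto
    qed
    show "full_from L R' 0 z (label b)"
      if "b \<in> stash R'" "z \<in> reads_since f ((a, y) # H) (addr b)" for b z
      using that by (intro full_S') (auto simp: M_stash)
    show "full_from L R' (Suc (fst v)) z (label b)"
      if b: "b \<in> real_blocks (tree R' v)" and z: "z \<in> reads_since f ((a, y) # H) (addr b)" for v b z
    proof (cases "onp v")
      case True
      then have bM: "b \<in> M (fst v)" "fst v \<le> L"
        using b rb_on by (auto simp: onp_def)
      show ?thesis
      proof (rule full_S')
        show "b \<in> S'"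
          using M(1)[OF bM(2)] bM(1) by blast
        show "b \<notin> (\<Union>l'\<in>{l..L}. M l')" if "Suc (fst v) \<le> l" for l
          by (rule M_mem[OF bM(1) _ bM(2)]) (use that in simp)
      qed (rule z)
    next
      case False
      then show ?thesis
        using b z rb_off by (intro full_off) auto
    qed
  qed
qed

text \<open>
  \<open>T\<close> consists of the nodes all of whose ancestors are full. The blocks of \<open>T\<close> and of the stash
  cannot have been carried out of \<open>T\<close> by any path read since their last access.
\<close>

lemma stash_overflow_subtree:
  assumes inv: "oram_inv L f H R" and f: "\<And>a. f a < 2 ^ L" and H: "\<And>a y. (a, y) \<in> set H \<Longrightarrow> y < 2 ^ L"
  shows "\<exists>T\<in>top_subtrees L. card (stash R) + 5 * card T \<le> card (unevicted L T f H)"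
proof -
  define T where "T = {(l, k). l \<le> L \<and> k < 2 ^ l \<and> (\<forall>l'\<le>l. is_full (tree R (l', k div 2 ^ (l - l'))))}"
  have T: "T \<in> top_subtrees L"
  proof -
    have "(l, k div 2) \<in> T" if "(Suc l, k) \<in> T" for l k
    proof -
      have "k div 2 div 2 ^ (l - l') = k div 2 ^ (Suc l - l')" if "l' \<le> l" for l'
        using that by (simp add: Suc_diff_le div_mult2_eq)
      then show ?thesis
        using that by (auto simp: T_def)
    qed
    then show ?thesis
      unfolding top_subtrees_def by (auto simp: T_def)
  qed
  have path_T: "path_node L y l \<in> T \<longleftrightarrow> (\<forall>l'\<le>l. is_full (tree R (path_node L y l')))"
    if "l \<le> L" "y < 2 ^ L" for y l
  proof -
    have "y div 2 ^ (L - l) div 2 ^ (l - l') = y div 2 ^ (L - l')" if "l' \<le> l" for l'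
    proof -
      have "L - l' = (L - l) + (l - l')"
        using that \<open>l \<le> L\<close> by simp
      then show ?thesis
        by (simp add: power_add div_mult2_eq)
    qed
    then show ?thesis
      using that path_node_bound[OF that] by (auto simp: T_def path_node_def)
  qed
  note fin = oram_invD(1)[OF inv]
    and inj = oram_invD(3)[OF inv]
    and addrs = oram_invD(4)[OF inv]
    and labs = oram_invD(5)[OF inv]
    and disj = oram_invD(6,7)[OF inv]
    and loc = oram_invD(8)[OF inv]
    and full_stash = oram_invD(9)[OF inv]
    and full_tree = oram_invD(10)[OF inv]
  have finT: "finite T"
    using T by (rule finite_top_subtree)
  define Bs where "Bs = stash R \<union> (\<Union>v\<in>T. real_blocks (tree R v))"
  have cur: "current f H a < 2 ^ L" for a
    using current_cases[of f H a] f H by (metis)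
  have "addr ` Bs \<subseteq> unevicted L T f H"
  proof (rule image_subsetI)
    fix b assume b: "b \<in> Bs"
    define y where "y = label b"
    have bst: "b \<in> stored R"
      using b by (auto simp: Bs_def stored_def)
    then have y: "y = current f H (addr b)" "y < 2 ^ L"
      using labs cur by (auto simp: y_def)
    have "exit_node L T y \<in> virtual_exits L \<or> exit_node L T x \<noteq> exit_node L T y"
      if x: "x \<in> reads_since f H (addr b)" for x
    proof (rule ccontr)
      assume *: "\<not> ?thesis"
      define e where "e = exit_level L T y"
      have e: "e \<le> L" "path_node L y e \<notin> T"
        using * exit_level(1,2)[OF T, of y] by (auto simp: e_def virtual_exits_def exit_node_def)
      have eq: "path_node L x e = path_node L y e"
        using * by (metis e_def exit_node_def path_node_level)
      \<comment> \<open>\<open>d\<close> is the first level below the position of \<open>b\<close>,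
        and 0 for the stash. The buckets above \<open>d\<close> are full because the position lies
        in \<open>T\<close>, the shared ones from \<open>d\<close> on by the invariant. Together
        they would put the common exit node into \<open>T\<close>.\<close>
      obtain d where d: "full_from L R d x y" "\<And>l. l < d \<Longrightarrow> l \<le> L \<Longrightarrow> is_full (tree R (path_node L y l))"
      proof (cases "b \<in> stash R")
        case True
        then show ?thesis
          using that[of 0] full_stash[OF True x] by (simp add: y_def)
      next
        case False
        then obtain v where v: "v \<in> T" "b \<in> real_blocks (tree R v)"
          using b by (auto simp: Bs_def)
        then have "path_node L y (fst v) = v" "fst v \<le> L"
          using loc by (auto simp: y_def)
        then have "is_full (tree R (path_node L y l))" if "l < Suc (fst v)" for l
          using path_T[of "fst v" y] v(1) y(2) that by auto
        then show ?thesis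
          using that[of "Suc (fst v)"] full_tree[OF v(2) x] by (simp add: y_def)
      qed
      have "is_full (tree R (path_node L y l))" if "l \<le> e" for l
      proof (cases "l < d")
        case True
        then show ?thesis
          using d(2) that e by simp
      next
        case False
        moreover have "path_node L x l = path_node L y l"
          by (rule path_node_agree_above[OF eq that e(1)])
        ultimately show ?thesis
          using d(1) that e by (simp add: full_from_def)
      qed
      then show False
        using path_T[OF e(1) y(2)] e(2) by blast
    qed
    moreover have "addr b \<in> fst ` set H"
      using bst addrs by blast
    ultimately show "addr b \<in> unevicted L T f H"
      unfolding unevicted_def y(1) by blast
  qed
  moreover have "inj_on addr Bs"
    by (rule inj_on_subset[OF inj]) (auto simp: Bs_def stored_def)
  moreover have "finite (unevicted L T f H)"
    by (simp add: unevicted_def)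
  ultimately have "card Bs \<le> card (unevicted L T f H)"
    by (intro card_inj_on_le)
  moreover have "card Bs = card (stash R) + 5 * card T"
  proof -
    have "card (\<Union>v\<in>T. real_blocks (tree R v)) = (\<Sum>v\<in>T. card (real_blocks (tree R v)))"
      using finT disj(2) by (intro card_UN_disjoint) auto
    also have "\<dots> = (\<Sum>v\<in>T. 5)"
    proof (intro sum.cong refl)
      fix v assume "v \<in> T"
      then have "is_full (tree R v)"
        by (cases v) (auto simp: T_def)
      then show "card (real_blocks (tree R v)) = 5"
        by (simp add: is_full_def bucket_size_def)
    qed
    finally have "card (\<Union>v\<in>T. real_blocks (tree R v)) = 5 * card T"
      by simp
    moreover have "card Bs = card (stash R) + card (\<Union>v\<in>T. real_blocks (tree R v))"
      unfolding Bs_def using fin finT disj(1) by (intro card_Un_disjoint) auto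
    ultimately show ?thesis
      by simp
  qed
  ultimately show ?thesis
    using T by (intro bexI[of _ T]) auto
qed

section \<open>Recursive Path ORAM\<close>

lemma le_two_power_height: "n \<le> 2 ^ height n"
proof (cases "n = 0")
  case False
  then have n: "real n > 0" "log 2 (real n) \<ge> 0"
    by auto
  have "log 2 (real n) \<le> real (height n)"
    using n by (simp add: height_def)
  then have "real n \<le> 2 powr real (height n)"
    using n by (simp add: log_le_iff)
  then have "real n \<le> real (2 ^ height n)"
    by (simp add: powr_realpow)
  then show ?thesis
    by (simp only: of_nat_le_iff)
qed simp

lemma height_mono:
  assumes "m \<le> n"
  shows "height m \<le> height n"
proof (cases "m = 0")
  case True
  then show ?thesis
    by (simp add: height_def log_def)
next
  case False
  then show ?thesis
    using assms unfolding height_def by (intro nat_mono ceiling_mono) simp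
qed

lemma num_blocks_Suc_le:
  assumes "chi \<ge> 1"
  shows "num_blocks chi N (Suc i) \<le> num_blocks chi N i"
proof -
  have "real (num_blocks chi N i) / real chi \<le> real (num_blocks chi N i)"
    using assms by (simp add: divide_le_eq mult_left_mono[of 1 "real chi", simplified])
  then show ?thesis
    by (simp add: nat_le_iff ceiling_le_iff)
qed

lemma num_blocks_le:
  assumes "chi \<ge> 1"
  shows "num_blocks chi N i \<le> N"
proof (induction i)
  case (Suc i)
  then show ?case
    using num_blocks_Suc_le[OF assms, of N i] by linarith
qed simp

lemma div_less_num_blocks:
  assumes "chi \<ge> 1" "a < N"
  shows "a div chi ^ i < num_blocks chi N i"
proof (induction i)
  case (Suc i)
  let ?n = "num_blocks chi N i"
  have "real (a div chi ^ i div chi) * real chi \<le> real (a div chi ^ i)"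
    by (metis of_nat_le_iff of_nat_mult div_times_less_eq_dividend)
  also have "\<dots> < real ?n"
    using Suc by simp
  finally have "real (a div chi ^ i div chi) < real ?n / real chi"
    using assms by (simp add: less_divide_eq)
  then have "int (a div chi ^ i div chi) < \<lceil>real ?n / real chi\<rceil>"
    by (simp add: less_ceiling_iff)
  moreover have "a div chi ^ Suc i = a div chi ^ i div chi"
    by (simp only: power_Suc2 div_mult2_eq)
  ultimately show ?case
    by simp
qed (use assms in auto)

text \<open>The global history records for each operation the data address and the fresh labels of
  all ORAMs; each ORAM sees a projection of it.\<close>

definition history_at :: "nat \<Rightarrow> nat \<Rightarrow> (nat \<times> (nat \<Rightarrow> nat)) list \<Rightarrow> (nat \<times> nat) list" where
  "history_at chi i H = map (map_prod (\<lambda>a. a div chi ^ i) (\<lambda>f. f i)) H"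

abbreviation current_at ::
  "nat \<Rightarrow> (nat \<times> nat \<Rightarrow> nat) \<Rightarrow> (nat \<times> (nat \<Rightarrow> nat)) list \<Rightarrow> nat \<Rightarrow> nat \<Rightarrow> nat" where
  "current_at chi ini H i \<equiv> current (\<lambda>a. ini (i, a)) (history_at chi i H)"

definition level_inv ::
  "nat \<Rightarrow> nat \<Rightarrow> (nat \<times> nat \<Rightarrow> nat) \<Rightarrow> (nat \<times> (nat \<Rightarrow> nat)) list \<Rightarrow> nat \<Rightarrow> 'v oram \<Rightarrow> bool" where
  "level_inv chi N ini H i R \<longleftrightarrow>
     oram_inv (oram_height chi N i) (\<lambda>a. ini (i, a)) (history_at chi i H) R"

text \<open>The invariant also speaks of blocks that do not exist yet: for them
  \<open>lookup\<close> falls back to the initial content, which holds the initial labels. This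
  saves a case distinction at the first access to a block.\<close>

definition map_inv ::
  "nat \<Rightarrow> (nat \<Rightarrow> 'v) \<Rightarrow> (nat \<times> nat \<Rightarrow> nat) \<Rightarrow> (nat \<times> (nat \<Rightarrow> nat)) list \<Rightarrow> nat \<Rightarrow> 'v oram \<Rightarrow> bool" where
  "map_inv chi d0 ini H i R \<longleftrightarrow>
     (\<forall>a. \<exists>ls. lookup R a (initial_content chi d0 ini (Suc i) a) = Labels ls \<and> length ls = chi \<and>
        (\<forall>j<chi. ls ! j = current_at chi ini H i (a * chi + j)))"

lemma history_at_Cons [simp]:
  "history_at chi i ((a, f) # H) = (a div chi ^ i, f i) # history_at chi i H"
  by (simp add: history_at_def)

text \<open>The access to ORAM \<open>i + 1\<close> returns the current label for ORAM
  \<open>i\<close> and at once stores the fresh one, so this map agrees with \<open>H'\<close>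
  before ORAM \<open>i\<close> is accessed. The clause on \<open>j > i\<close> protects it during
  the recursive call.\<close>

lemma access_from_inv:
  fixes Rs :: "nat \<Rightarrow> 'v oram"
  assumes pick: "valid_policy pick" and chi: "chi \<ge> 1"
    and "\<And>j. j \<le> i \<Longrightarrow> level_inv chi N ini H j (Rs j)"
    and "\<And>j. j < i \<Longrightarrow> map_inv chi d0 ini H j (Rs (Suc j))"
    and "x = current_at chi ini H i (op_addr opn div chi ^ i)"
    and "access_from chi N pick d0 ini opn fresh i x Rs = (Rs', Ts)"
  defines "H' \<equiv> (op_addr opn, fresh) # H"
  shows "(\<forall>j\<le>i. level_inv chi N ini H' j (Rs' j)) \<and>
    (\<forall>j<i. map_inv chi d0 ini H' j (Rs' (Suc j))) \<and>
    (\<forall>j>i. Rs' j = Rs j) \<and>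
    (\<forall>j\<le>i. blocks_transferred (Ts j) = 2 * Suc (oram_height chi N j) * bucket_size)"
  using assms(3-6)
proof (induction i arbitrary: x Rs Rs' Ts)
  case 0
  obtain c R' T where acc: "access pick 0 (oram_height chi N 0) (initial_content chi d0 ini 0 (op_addr opn))
      (op_addr opn) x (fresh 0) (op_update opn) (Rs 0) = (c, R', T)"
    by (metis prod_cases3)
  have inv: "oram_inv (oram_height chi N 0) (\<lambda>a. ini (0, a)) (history_at chi 0 H) (Rs 0)"
    using 0(1)[of 0] by (simp add: level_inv_def)
  have x: "x = current (\<lambda>a. ini (0, a)) (history_at chi 0 H) (op_addr opn)"
    using 0(3) by simp
  have res: "Rs' = Rs(0 := R')" "Ts = (\<lambda>_. [])(0 := T)"
    using 0(4) acc by auto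
  show ?case
    using access_inv(1,5)[OF inv pick x acc] by (simp add: res level_inv_def H'_def)
next
  case (Suc i)
  define a where "a = op_addr opn div chi ^ Suc i"
  define slot where "slot = (op_addr opn div chi ^ i) mod chi"
  define upd where "upd = (\<lambda>c :: 'v content. Labels ((labels c)[slot := fresh i]) :: 'v content)"
  have addr: "op_addr opn div chi ^ i = a * chi + slot"
  proof -
    have "a = op_addr opn div chi ^ i div chi"
      unfolding a_def by (simp only: power_Suc2 div_mult2_eq)
    then show ?thesis
      by (simp add: slot_def)
  qed
  have slot: "slot < chi"
    using chi by (simp add: slot_def)
  obtain c R' T where acc: "access pick (Suc i) (oram_height chi N (Suc i)) (initial_content chi d0 ini (Suc i) a)
      a x (fresh (Suc i)) upd (Rs (Suc i)) = (c, R', T)"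
    by (metis prod_cases3)
  obtain Rs1 Ts1 where rec: "access_from chi N pick d0 ini opn fresh i (labels c ! slot) (Rs(Suc i := R')) = (Rs1, Ts1)"
    by (metis surj_pair)
  have res: "Rs' = Rs1" "Ts = Ts1(Suc i := T)"
    using Suc.prems(4) acc rec by (auto simp: a_def slot_def upd_def Let_def simp del: initial_content.simps)
  have inv: "oram_inv (oram_height chi N (Suc i)) (\<lambda>a. ini (Suc i, a)) (history_at chi (Suc i) H) (Rs (Suc i))"
    using Suc.prems(1)[of "Suc i"] by (simp add: level_inv_def)
  have x: "x = current (\<lambda>a. ini (Suc i, a)) (history_at chi (Suc i) H) a"
    using Suc.prems(3) by (simp add: a_def)
  note A = access_inv[OF inv pick x acc]
  have mi: "map_inv chi d0 ini H i (Rs (Suc i))"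
    using Suc.prems(2)[of i] by simp
  then obtain ls where ls: "lookup (Rs (Suc i)) a (initial_content chi d0 ini (Suc i) a) = Labels ls"
    "length ls = chi" "\<And>j. j < chi \<Longrightarrow> ls ! j = current_at chi ini H i (a * chi + j)"
    unfolding map_inv_def by blast
  have c: "c = Labels ls"
    using A(2) ls(1) by simp
  have IH: "(\<forall>j\<le>i. level_inv chi N ini H' j (Rs1 j)) \<and>
      (\<forall>j<i. map_inv chi d0 ini H' j (Rs1 (Suc j))) \<and>
      (\<forall>j>i. Rs1 j = (Rs(Suc i := R')) j) \<and>
      (\<forall>j\<le>i. blocks_transferred (Ts1 j) = 2 * Suc (oram_height chi N j) * bucket_size)"
  proof (rule Suc.IH[OF _ _ _ rec])
    show "level_inv chi N ini H j ((Rs(Suc i := R')) j)" if "j \<le> i" for j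
      using Suc.prems(1)[of j] that by simp
    show "map_inv chi d0 ini H j ((Rs(Suc i := R')) (Suc j))" if "j < i" for j
      using Suc.prems(2)[of j] that by simp
    show "labels c ! slot = current_at chi ini H i (op_addr opn div chi ^ i)"
      using ls(3)[OF slot] by (simp add: c addr)
  qed
  have Rs1: "Rs1 (Suc i) = R'" "\<And>j. j > Suc i \<Longrightarrow> Rs1 j = Rs j"
    using IH by auto
  have level: "level_inv chi N ini H' (Suc i) R'"
    using A(1) by (simp add: level_inv_def H'_def a_def)
  have "map_inv chi d0 ini H' i R'"
    unfolding map_inv_def
  proof
    fix a'
    show "\<exists>ls. lookup R' a' (initial_content chi d0 ini (Suc i) a') = Labels ls \<and> length ls = chi \<and>
        (\<forall>j<chi. ls ! j = current_at chi ini H' i (a' * chi + j))"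
    proof (cases "a' = a")
      case True
      have "ls[slot := fresh i] ! j = current_at chi ini H' i (a' * chi + j)" if "j < chi" for j
        using that ls(2,3) by (simp add: H'_def addr True nth_list_update)
      then show ?thesis
        using ls(2) A(3)[of "initial_content chi d0 ini (Suc i) a'"] True
        by (intro exI[of _ "ls[slot := fresh i]"]) (simp add: upd_def c del: initial_content.simps)
    next
      case False
      obtain ls' where ls': "lookup (Rs (Suc i)) a' (initial_content chi d0 ini (Suc i) a') = Labels ls'"
        "length ls' = chi" "\<And>j. j < chi \<Longrightarrow> ls' ! j = current_at chi ini H i (a' * chi + j)"
        using mi unfolding map_inv_def by blast
      have "a' * chi + j \<noteq> a * chi + slot" if "j < chi" for j
      proof
        assume "a' * chi + j = a * chi + slot"
        then have "(a' * chi + j) div chi = (a * chi + slot) div chi"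
          by simp
        then show False
          using that slot False by simp
      qed
      then show ?thesis
        using ls' A(4)[OF False, of "initial_content chi d0 ini (Suc i) a'"]
        by (intro exI[of _ ls']) (simp add: H'_def addr del: initial_content.simps)
    qed
  qed
  then show ?case
    using IH Rs1 level A(5) unfolding res
    by (auto simp: le_Suc_eq less_Suc_eq)
qed

definition system_inv ::
  "nat \<Rightarrow> nat \<Rightarrow> (nat \<Rightarrow> 'v) \<Rightarrow> (nat \<times> nat \<Rightarrow> nat) \<Rightarrow> (nat \<times> (nat \<Rightarrow> nat)) list \<Rightarrow> 'v rec_oram \<Rightarrow> bool" where
  "system_inv chi N d0 ini H s \<longleftrightarrow>
     (\<forall>j\<le>top_oram chi N. level_inv chi N ini H j (oram s j)) \<and>
     (\<forall>j<top_oram chi N. map_inv chi d0 ini H j (oram s (Suc j))) \<and>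
     (\<forall>a. client_map s a = current_at chi ini H (top_oram chi N) a)"

definition transfer_ok :: "nat \<Rightarrow> nat \<Rightarrow> 'v transfer \<Rightarrow> bool" where
  "transfer_ok chi N Ts \<longleftrightarrow>
     (\<forall>j\<le>top_oram chi N. blocks_transferred (Ts j) = 2 * Suc (oram_height chi N j) * bucket_size)"

lemma system_inv_initial: "system_inv chi N d0 ini [] (initial_state chi N ini)"
proof -
  have "stored empty_oram = ({} :: 'a block set)"
    by (simp add: stored_def empty_oram_def)
  then have "lookup empty_oram a c0 = c0" for a and c0 :: "'a content"
    by (simp add: lookup_absent)
  then show ?thesis
    by (simp add: system_inv_def initial_state_def level_inv_def map_inv_def history_at_def oram_inv_empty)
qed

lemma perform_inv:
  assumes "valid_policy pick" "chi \<ge> 1" "system_inv chi N d0 ini H s"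
    and "perform chi N pick d0 ini opn fresh s = (s', Ts)"
  shows "system_inv chi N d0 ini ((op_addr opn, fresh) # H) s' \<and> transfer_ok chi N Ts"
proof -
  let ?X = "top_oram chi N"
  obtain Rs Ts' where acc: "access_from chi N pick d0 ini opn fresh ?X
      (client_map s (op_addr opn div chi ^ ?X)) (oram s) = (Rs, Ts')"
    by (metis surj_pair)
  have res: "s' = \<lparr>oram = Rs, client_map = (client_map s)(op_addr opn div chi ^ ?X := fresh ?X)\<rparr>" "Ts = Ts'"
    using assms(4) acc by (auto simp: perform_def Let_def)
  show ?thesis
    using access_from_inv[OF assms(1,2) _ _ _ acc, of H] assms(3)
    unfolding res system_inv_def transfer_ok_def by simp
qed

section \<open>Executions as functions of the labels\<close>

text \<open>\<open>w k\<close> are the fresh labels for the operation that is followed by \<open>k\<close> more operations.\<close>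

fun execute ::
  "nat \<Rightarrow> nat \<Rightarrow> 'v policy \<Rightarrow> (nat \<Rightarrow> 'v) \<Rightarrow> (nat \<times> nat \<Rightarrow> nat) \<Rightarrow> (nat \<Rightarrow> nat \<Rightarrow> nat) \<Rightarrow> 'v operation list
    \<Rightarrow> 'v rec_oram \<Rightarrow> 'v execution" where
  "execute chi N pick d0 ini w [] s = []"
| "execute chi N pick d0 ini w (opn # ops) s =
     (let r = perform chi N pick d0 ini opn (w (length ops)) s
      in r # execute chi N pick d0 ini w ops (fst r))"

text \<open>The type of labels is left open: with \<open>Inr\<close> for \<open>w\<close> the same
  function yields histories of label names, which depend on the addresses alone.\<close>

fun histories :: "(nat \<Rightarrow> 'l) \<Rightarrow> nat list \<Rightarrow> (nat \<times> 'l) list \<Rightarrow> (nat \<times> 'l) list list" where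
  "histories w [] H = []"
| "histories w (a # as) H = ((a, w (length as)) # H) # histories w as ((a, w (length as)) # H)"

lemma length_histories [simp]: "length (histories w as H) = length as"
  by (induction as arbitrary: H) auto

lemma histories_map:
  "histories (\<lambda>k. g (w k)) (map h as) (map (map_prod h g) H) = map (map (map_prod h g)) (histories w as H)"
proof (induction as arbitrary: H)
  case (Cons a as)
  from Cons.IH[of "(a, w (length as)) # H"] show ?case
    by simp
qed simp

lemma histories_distinct:
  assumes "G \<in> set (histories w as H)" "inj w" "distinct (map snd H)" "snd ` set H \<inter> w ` {..<length as} = {}"
  shows "distinct (map snd G) \<and> snd ` set G \<subseteq> snd ` set H \<union> w ` {..<length as} \<and>
    fst ` set G \<subseteq> fst ` set H \<union> set as"
  using assms
proof (induction as arbitrary: H)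
  case (Cons a as)
  define H' where "H' = (a, w (length as)) # H"
  have ivl: "{..<length (a # as)} = insert (length as) {..<length as}"
    by auto
  have "w (length as) \<notin> snd ` set H"
    using Cons.prems(4) unfolding ivl by blast
  then have d: "distinct (map snd H')"
    using Cons.prems(3) by (simp add: H'_def)
  have "w (length as) \<notin> w ` {..<length as}"
    using Cons.prems(2) by (auto simp: inj_on_def)
  then have disj: "snd ` set H' \<inter> w ` {..<length as} = {}"
    using Cons.prems(4) unfolding ivl by (auto simp: H'_def)
  have sub: "snd ` set H' \<subseteq> snd ` set H \<union> w ` {..<length (a # as)}" "fst ` set H' \<subseteq> fst ` set H \<union> set (a # as)"
    by (auto simp: H'_def)
  from Cons.prems(1) consider "G = H'" | "G \<in> set (histories w as H')"
    by (auto simp: H'_def)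
  then show ?case
  proof cases
    case 1
    then show ?thesis
      using d sub by simp
  next
    case 2
    note IH = Cons.IH[OF 2 Cons.prems(2) d disj]
    show ?thesis
    proof (intro conjI)
      show "distinct (map snd G)"
        using IH by simp
      show "snd ` set G \<subseteq> snd ` set H \<union> w ` {..<length (a # as)}"
        by (rule order_trans[OF IH[THEN conjunct2, THEN conjunct1]], rule Un_least[OF sub(1)]) auto
      show "fst ` set G \<subseteq> fst ` set H \<union> set (a # as)"
        by (rule order_trans[OF IH[THEN conjunct2, THEN conjunct2]], rule Un_least[OF sub(2)]) auto
    qed
  qed
qed simp

lemma execute_inv:
  assumes "valid_policy pick" "chi \<ge> 1" "system_inv chi N d0 ini H s"
  shows "list_all2 (\<lambda>p G. system_inv chi N d0 ini G (fst p) \<and> transfer_ok chi N (snd p))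
    (execute chi N pick d0 ini w ops s) (histories w (map op_addr ops) H)"
  using assms(3)
proof (induction ops arbitrary: H s)
  case (Cons opn ops)
  obtain s' Ts where p: "perform chi N pick d0 ini opn (w (length ops)) s = (s', Ts)"
    by (metis surj_pair)
  note inv = perform_inv[OF assms(1,2) Cons.prems p]
  show ?case
    using Cons.IH[of "(op_addr opn, w (length ops)) # H" s'] inv p by simp
qed simp

lemma execute_cong:
  assumes "\<And>k. k < length ops \<Longrightarrow> w k = w' k"
  shows "execute chi N pick d0 ini w ops s = execute chi N pick d0 ini w' ops s"
  using assms by (induction ops arbitrary: s) (auto simp: Let_def)

text \<open>All fresh labels can be drawn in advance. Counting operations from the end gives the
  remaining operations exactly the indices below \<open>length ops\<close>, which the labels of the
  current operation do not touch.\<close>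

lemma run_from_eq:
  "run_from chi N pick d0 ini ops s =
     map_pmf (\<lambda>w. execute chi N pick d0 ini w ops s) (Pi_pmf {..<length ops} d (\<lambda>_. fresh_labels chi N))"
proof (induction ops arbitrary: s)
  case (Cons opn ops)
  let ?n = "length ops" and ?P = "Pi_pmf {..<length ops} d (\<lambda>_. fresh_labels chi N)"
  have upd: "execute chi N pick d0 ini (w(?n := fresh)) ops s' = execute chi N pick d0 ini w ops s'" for w fresh s'
    by (rule execute_cong) auto
  have "Pi_pmf {..<Suc ?n} d (\<lambda>_. fresh_labels chi N) =
      fresh_labels chi N \<bind> (\<lambda>fresh. ?P \<bind> (\<lambda>w. return_pmf (w(?n := fresh))))"
    unfolding lessThan_Suc by (subst Pi_pmf_insert') auto
  then show ?case
    by (simp add: Let_def case_prod_beta Cons.IH map_bind_pmf map_pmf_comp upd)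
       (simp add: map_pmf_def bind_assoc_pmf bind_return_pmf)
qed simp

lemma run_eq:
  "run chi N pick d0 ops =
     map_pmf (\<lambda>(ini, w). execute chi N pick d0 ini w ops (initial_state chi N ini))
       (pair_pmf (initial_labels chi N) (Pi_pmf {..<length ops} d (\<lambda>_. fresh_labels chi N)))"
  unfolding run_def run_from_eq[where d = d] pair_pmf_def
  by (simp add: map_pmf_def bind_assoc_pmf bind_return_pmf)

section \<open>The labels of one ORAM as independent uniform variables\<close>

lemma Pi_pmf_case_sum:
  assumes "finite A" "finite B"
  shows "map_pmf (\<lambda>(f, g). case_sum f g) (pair_pmf (Pi_pmf A d (\<lambda>_. p)) (Pi_pmf B d (\<lambda>_. p))) =
    Pi_pmf (A <+> B) d (\<lambda>_. p)"
proof (rule pmf_eqI)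
  fix h :: "'a + 'b \<Rightarrow> 'c"
  let ?m = "\<lambda>(f, g). case_sum f g :: 'a + 'b \<Rightarrow> 'c"
  have inj: "inj ?m"
  proof (rule injI)
    fix u v :: "('a \<Rightarrow> 'c) \<times> ('b \<Rightarrow> 'c)"
    assume eq: "?m u = ?m v"
    have "fst u = fst v"
    proof
      show "fst u a = fst v a" for a
        using fun_cong[OF eq, of "Inl a"] by (simp add: case_prod_beta)
    qed
    moreover have "snd u = snd v"
    proof
      show "snd u b = snd v b" for b
        using fun_cong[OF eq, of "Inr b"] by (simp add: case_prod_beta)
    qed
    ultimately show "u = v"
      by (rule prod_eqI)
  qed
  have h: "h = ?m (h \<circ> Inl, h \<circ> Inr)"
    by (auto simp: fun_eq_iff split: sum.splits)
  have "pmf (map_pmf ?m (pair_pmf (Pi_pmf A d (\<lambda>_. p)) (Pi_pmf B d (\<lambda>_. p)))) h =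
      pmf (Pi_pmf A d (\<lambda>_. p)) (h \<circ> Inl) * pmf (Pi_pmf B d (\<lambda>_. p)) (h \<circ> Inr)"
    by (subst h, subst pmf_map_inj'[OF inj]) (simp add: pmf_pair)
  also have "\<dots> = pmf (Pi_pmf (A <+> B) d (\<lambda>_. p)) h"
  proof (cases "\<forall>k. k \<notin> A <+> B \<longrightarrow> h k = d")
    case True
    then have "\<forall>a. a \<notin> A \<longrightarrow> h (Inl a) = d" "\<forall>b. b \<notin> B \<longrightarrow> h (Inr b) = d"
      by auto
    then show ?thesis
      using True assms by (simp add: pmf_Pi prod.Plus)
  next
    case False
    then have "(\<exists>a. a \<notin> A \<and> h (Inl a) \<noteq> d) \<or> (\<exists>b. b \<notin> B \<and> h (Inr b) \<noteq> d)"
      by (metis InlI InrI sum.exhaust)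
    then show ?thesis
      using False assms by (auto simp: pmf_Pi)
  qed
  finally show "pmf (map_pmf ?m (pair_pmf (Pi_pmf A d (\<lambda>_. p)) (Pi_pmf B d (\<lambda>_. p)))) h =
      pmf (Pi_pmf (A <+> B) d (\<lambda>_. p)) h" .
qed

lemma Pi_pmf_slice:
  assumes "finite I" "\<And>i. i \<in> I \<Longrightarrow> finite (A i)" "i \<in> I"
  shows "map_pmf (\<lambda>f a. f (i, a)) (Pi_pmf (Sigma I A) d (\<lambda>(i, a). p i)) = Pi_pmf (A i) d (\<lambda>_. p i)"
proof -
  let ?P = "Pi_pmf (Sigma I A) d (\<lambda>(i, a). p i)"
  have fin: "finite (Sigma I A)"
    using assms by auto
  have bij: "bij_betw (Pair i) (A i) ({i} \<times> A i)"
    by (auto simp: bij_betw_def inj_on_def)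
  have "Pi_pmf (A i) d (\<lambda>_. p i) = map_pmf (\<lambda>f. f \<circ> Pair i) (Pi_pmf ({i} \<times> A i) d (\<lambda>_. p i))"
    using assms by (intro Pi_pmf_bij_betw[OF _ bij]) auto
  also have "Pi_pmf ({i} \<times> A i) d (\<lambda>_. p i) = Pi_pmf ({i} \<times> A i) d (\<lambda>(i, a). p i)"
    using assms by (intro Pi_pmf_cong) auto
  also have "Pi_pmf ({i} \<times> A i) d (\<lambda>(i, a). p i) = map_pmf (\<lambda>f k. if k \<in> {i} \<times> A i then f k else d) ?P"
    using assms fin by (intro Pi_pmf_subset) auto
  also have "map_pmf (\<lambda>f. f \<circ> Pair i) \<dots> = map_pmf (\<lambda>f a. f (i, a)) ?P"
    unfolding map_pmf_comp
  proof (rule map_pmf_cong[OF refl])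
    fix f assume "f \<in> set_pmf ?P"
    with set_Pi_pmf_subset[OF fin] have "f \<in> {f. \<forall>k. k \<notin> Sigma I A \<longrightarrow> f k = d}"
      by (rule subsetD)
    then show "(\<lambda>k. if k \<in> {i} \<times> A i then f k else d) \<circ> Pair i = (\<lambda>a. f (i, a))"
      by (auto simp: fun_eq_iff)
  qed
  finally show ?thesis ..
qed

text \<open>Projecting to one level leaves independent uniform labels, the initial ones under
  \<open>Inl\<close> and the fresh ones under \<open>Inr\<close>. The default of a whole row of
  fresh labels is \<open>\<lambda>_. 0\<close>, so that its projection has the same default 0 as the
  initial labels.\<close>

lemma labels_at_distribution:
  fixes n :: nat
  assumes "i \<le> top_oram chi N"
  shows "map_pmf (\<lambda>(ini, w). case_sum (\<lambda>a. ini (i, a)) (\<lambda>k. w k i))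
      (pair_pmf (initial_labels chi N) (Pi_pmf {..<n} (\<lambda>_. 0) (\<lambda>_. fresh_labels chi N))) =
    Pi_pmf ({..<num_blocks chi N i} <+> {..<n}) 0 (\<lambda>_. random_label chi N i)"
proof -
  let ?I = "initial_labels chi N" and ?F = "Pi_pmf {..<n} (\<lambda>_. 0) (\<lambda>_. fresh_labels chi N)"
  have I: "map_pmf (\<lambda>ini a. ini (i, a)) ?I = Pi_pmf {..<num_blocks chi N i} 0 (\<lambda>_. random_label chi N i)"
    unfolding initial_labels_def using assms by (intro Pi_pmf_slice) auto
  have "map_pmf (\<lambda>f. f i) (fresh_labels chi N) = random_label chi N i"
    unfolding fresh_labels_def using assms by (subst Pi_pmf_component) auto
  then have F: "map_pmf (\<lambda>w k. w k i) ?F = Pi_pmf {..<n} 0 (\<lambda>_. random_label chi N i)"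
    using Pi_pmf_map[OF finite_lessThan[of n], where f = "\<lambda>f. f i" and dflt = "\<lambda>_. 0" and dflt' = 0
      and g = "\<lambda>_. fresh_labels chi N", symmetric]
    by (simp add: comp_def)
  have "map_pmf (\<lambda>(ini, w). case_sum (\<lambda>a. ini (i, a)) (\<lambda>k. w k i)) (pair_pmf ?I ?F) =
      map_pmf (\<lambda>(f, g). case_sum f g) (map_pmf (\<lambda>(ini, w). ((\<lambda>a. ini (i, a)), (\<lambda>k. w k i))) (pair_pmf ?I ?F))"
    by (simp add: map_pmf_comp case_prod_unfold)
  also have "map_pmf (\<lambda>(ini, w). ((\<lambda>a. ini (i, a)), (\<lambda>k. w k i))) (pair_pmf ?I ?F) =
      pair_pmf (map_pmf (\<lambda>ini a. ini (i, a)) ?I) (map_pmf (\<lambda>w k. w k i) ?F)"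
    by (simp add: map_pair)
  finally show ?thesis
    unfolding I F by (simp add: Pi_pmf_case_sum)
qed

section \<open>Bandwidth and failure probability\<close>

lemma run_transfer_ok:
  assumes "valid_policy pick" "chi \<ge> 1" "E \<in> set_pmf (run chi N pick d0 ops)" "(s, Ts) \<in> set E"
  shows "transfer_ok chi N Ts"
proof -
  obtain ini w where E: "E = execute chi N pick d0 ini w ops (initial_state chi N ini)"
    using assms(3) unfolding run_eq[where d = undefined] by auto
  then show ?thesis
    using assms(4) execute_inv[OF assms(1,2) system_inv_initial, of N d0 ini w ops]
    by (auto simp: list_all2_conv_all_nth in_set_conv_nth)
qed

text \<open>A union bound over the ORAMs and over the ends of the operations. As the operations are
  fixed in advance, each ORAM goes through the fixed list \<open>Gs i\<close> of symbolic histories;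
  only their evaluation by \<open>v i\<close> is random, and it involves the labels of ORAM
  \<open>i\<close> alone.\<close>

lemma failure_prob_bound:
  fixes pick :: "'v policy" and ops :: "'v operation list"
  assumes "valid_policy pick" "chi \<ge> 1" and ops: "\<And>opn. opn \<in> set ops \<Longrightarrow> op_addr opn < N"
  shows "failure_prob chi N cap pick d0 ops
    \<le> (\<Sum>i\<le>top_oram chi N. real (length ops) * (6 * (3/5) ^ cap i))"
proof -
  let ?X = "top_oram chi N"
  define Q where "Q = pair_pmf (initial_labels chi N) (Pi_pmf {..<length ops} (\<lambda>_. 0) (\<lambda>_. fresh_labels chi N))"
  define v where "v i = (\<lambda>(ini, w). case_sum (\<lambda>a. ini (i, a)) (\<lambda>k. w k i) :: nat + nat \<Rightarrow> nat)"
    for i :: nat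
  define L where "L i = oram_height chi N i" for i
  define I where "I i = {..<num_blocks chi N i} <+> {..<length ops}" for i
  define P where "P i = Pi_pmf (I i) 0 (\<lambda>_. pmf_of_set {..<2 ^ L i :: nat})" for i
  define Gs where "Gs i = histories (Inr :: nat \<Rightarrow> nat + nat) (map (\<lambda>a. a div chi ^ i) (map op_addr ops)) []" for i
  define Bad where "Bad i G = {u. \<exists>T\<in>top_subtrees (L i). cap i + 5 * card T \<le>
    card (unevicted (L i) T (u \<circ> Inl) (map (apsnd u) G))}" for i and G :: "(nat \<times> (nat + nat)) list"
  have P: "map_pmf (v i) Q = P i" if "i \<le> ?X" for i
    unfolding Q_def P_def I_def L_def v_def
    using labels_at_distribution[OF that, of "length ops"] by (simp add: random_label_def)
  have finI: "finite (I i)" for i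
    by (simp add: I_def)
  have lt: "u k < 2 ^ L i" if "u \<in> set_pmf (P i)" for u k i
  proof -
    have "u \<in> PiE_dflt (I i) 0 (set_pmf \<circ> (\<lambda>_. pmf_of_set {..<2 ^ L i}))"
      using that set_Pi_pmf_subset'[OF finI, of i 0 "\<lambda>_. pmf_of_set {..<2 ^ L i}"] unfolding P_def by blast
    then show ?thesis
      by (cases "k \<in> I i") (auto simp: PiE_dflt_def lessThan_empty_iff)
  qed
  have bad: "measure_pmf.prob Q (v i -` Bad i G) \<le> 6 * (3/5) ^ cap i"
    if i: "i \<le> ?X" and G: "G \<in> set (Gs i)" for i G
  proof -
    have G': "distinct (map snd G)" "snd ` set G \<subseteq> Inr ` {..<length ops}"
      "fst ` set G \<subseteq> set (map (\<lambda>a. a div chi ^ i) (map op_addr ops))"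
      using histories_distinct[OF G[unfolded Gs_def]] by auto
    have "measure_pmf.prob Q (v i -` Bad i G) = measure_pmf.prob (P i) (Bad i G)"
      by (simp add: P[OF i, symmetric])
    also have "\<dots> \<le> 6 * (3/5) ^ cap i"
      unfolding P_def Bad_def
    proof (rule prob_unevicted[OF finI])
      show "fst ` set G \<subseteq> {..<num_blocks chi N i}"
      proof
        fix a assume "a \<in> fst ` set G"
        then obtain opn where "opn \<in> set ops" "a = op_addr opn div chi ^ i"
          using G'(3) by auto
        then show "a \<in> {..<num_blocks chi N i}"
          using div_less_num_blocks[OF assms(2) ops] by simp
      qed
      show "num_blocks chi N i \<le> 2 ^ L i"
        unfolding L_def oram_height_def by (rule le_two_power_height)
      show "Inl ` {..<num_blocks chi N i} \<subseteq> I i" "snd ` set G \<subseteq> I i"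
        using G'(2) by (auto simp: I_def)
      show "distinct (map snd G)" "snd ` set G \<subseteq> range Inr"
        using G' by auto
    qed
    finally show ?thesis .
  qed
  \<comment> \<open>Every state reached is described by an evaluated symbolic history, and an
    overfull stash makes the evaluation bad for that history.\<close>
  have incl: "\<exists>i\<le>?X. \<exists>G\<in>set (Gs i). v i (ini, w) \<in> Bad i G"
    if supp: "(ini, w) \<in> set_pmf Q"
      and exc: "storage_exceeded chi N cap (execute chi N pick d0 ini w ops (initial_state chi N ini))" for ini w
  proof -
    obtain s Ts i where s: "(s, Ts) \<in> set (execute chi N pick d0 ini w ops (initial_state chi N ini))"
      and i: "i \<le> ?X" "cap i < card (stash (oram s i))"
      using exc unfolding storage_exceeded_def by blast
    have "list_all2 (\<lambda>p G. system_inv chi N d0 ini G (fst p) \<and> transfer_ok chi N (snd p))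
        (execute chi N pick d0 ini w ops (initial_state chi N ini)) (histories w (map op_addr ops) [])"
      by (rule execute_inv[OF assms(1,2) system_inv_initial])
    then obtain H where H: "H \<in> set (histories w (map op_addr ops) [])" "system_inv chi N d0 ini H s"
      using s by (auto simp: list_all2_conv_all_nth in_set_conv_nth) (metis fst_conv)
    have inv: "oram_inv (L i) (\<lambda>a. ini (i, a)) (history_at chi i H) (oram s i)"
      using H(2) i(1) by (simp add: system_inv_def level_inv_def L_def)
    define u where "u = v i (ini, w)"
    have "u \<in> set_pmf (P i)"
      using supp unfolding P[OF i(1), symmetric] u_def by auto
    note u_lt = lt[OF this]
    have u: "u (Inl a) = ini (i, a)" "u (Inr k) = w k i" for a k
      by (simp_all add: u_def v_def)
    have "history_at chi i H \<in> set (map (history_at chi i) (histories w (map op_addr ops) []))"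
      using H(1) by auto
    also have "map (history_at chi i) (histories w (map op_addr ops) []) =
        histories (\<lambda>k. w k i) (map (\<lambda>a. a div chi ^ i) (map op_addr ops)) []"
      using histories_map[of "\<lambda>f. f i" w "\<lambda>a. a div chi ^ i" "map op_addr ops" "[]"]
      by (simp add: history_at_def[abs_def])
    also have "\<dots> = map (map (apsnd u)) (Gs i)"
      using histories_map[of u Inr id "map (\<lambda>a. a div chi ^ i) (map op_addr ops)" "[]"]
      by (simp add: u Gs_def apsnd_def)
    finally obtain G where G: "G \<in> set (Gs i)" "history_at chi i H = map (apsnd u) G"
      by auto
    have f: "(\<lambda>a. ini (i, a)) = u \<circ> Inl"
      by (simp add: fun_eq_iff u)
    have "\<exists>T\<in>top_subtrees (L i). card (stash (oram s i)) + 5 * card T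
        \<le> card (unevicted (L i) T (u \<circ> Inl) (map (apsnd u) G))"
      using inv unfolding f G(2) by (rule stash_overflow_subtree) (use u_lt in auto)
    then obtain T where "T \<in> top_subtrees (L i)"
      "card (stash (oram s i)) + 5 * card T \<le> card (unevicted (L i) T (u \<circ> Inl) (map (apsnd u) G))"
      by blast
    then have "u \<in> Bad i G"
      using i(2) unfolding Bad_def by (intro CollectI bexI[of _ T]) linarith+
    then show ?thesis
      using i(1) G(1) unfolding u_def by blast
  qed
  have "failure_prob chi N cap pick d0 ops = measure_pmf.prob Q
      {(ini, w). storage_exceeded chi N cap (execute chi N pick d0 ini w ops (initial_state chi N ini))}"
    unfolding failure_prob_def run_eq[where d = "\<lambda>_. 0"] Q_def[symmetric] measure_map_pmf
    by (rule arg_cong[where f = "measure_pmf.prob Q"]) auto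
  also have "\<dots> \<le> measure_pmf.prob Q (\<Union>i\<in>{..?X}. \<Union>G\<in>set (Gs i). v i -` Bad i G)"
  proof (rule measure_pmf.finite_measure_mono_AE)
    show "AE p in measure_pmf Q. p \<in> {(ini, w). storage_exceeded chi N cap
        (execute chi N pick d0 ini w ops (initial_state chi N ini))} \<longrightarrow>
        p \<in> (\<Union>i\<in>{..?X}. \<Union>G\<in>set (Gs i). v i -` Bad i G)"
      unfolding AE_measure_pmf_iff
    proof (intro ballI impI)
      fix p assume p: "p \<in> set_pmf Q" "p \<in> {(ini, w). storage_exceeded chi N cap
          (execute chi N pick d0 ini w ops (initial_state chi N ini))}"
      obtain ini w where "p = (ini, w)"
        by (cases p)
      with p incl[of ini w] show "p \<in> (\<Union>i\<in>{..?X}. \<Union>G\<in>set (Gs i). v i -` Bad i G)"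
        by auto
    qed
  qed simp
  also have "\<dots> \<le> (\<Sum>i\<in>{..?X}. measure_pmf.prob Q (\<Union>G\<in>set (Gs i). v i -` Bad i G))"
    by (rule measure_pmf.finite_measure_subadditive_finite) auto
  also have "\<dots> \<le> (\<Sum>i\<in>{..?X}. real (length ops) * (6 * (3/5) ^ cap i))"
  proof (rule sum_mono)
    fix i assume "i \<in> {..?X}"
    then have i: "i \<le> ?X"
      by simp
    have "measure_pmf.prob Q (\<Union>G\<in>set (Gs i). v i -` Bad i G)
        \<le> (\<Sum>G\<in>set (Gs i). measure_pmf.prob Q (v i -` Bad i G))"
      by (rule measure_pmf.finite_measure_subadditive_finite) auto
    also have "\<dots> \<le> (\<Sum>G\<in>set (Gs i). 6 * (3/5) ^ cap i)"
      using bad[OF i] by (rule sum_mono)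
    also have "\<dots> = real (card (set (Gs i))) * (6 * (3/5) ^ cap i)"
      by simp
    also have "\<dots> \<le> real (length ops) * (6 * (3/5) ^ cap i)"
    proof (rule mult_right_mono)
      have "card (set (Gs i)) \<le> length (Gs i)"
        by (rule card_length)
      then show "real (card (set (Gs i))) \<le> real (length ops)"
        by (simp add: Gs_def)
    qed simp
    finally show "measure_pmf.prob Q (\<Union>G\<in>set (Gs i). v i -` Bad i G)
        \<le> real (length ops) * (6 * (3/5) ^ cap i)" .
  qed
  finally show ?thesis
    by simp
qed

section \<open>Asymptotics\<close>

text \<open>The summand 1 absorbs all roundings, since it is fixed by the map from \<open>n\<close>
  to \<open>(n + 1) / 2\<close>. After \<open>height N\<close> steps at most
  \<open>2 \<le> chi\<close> blocks are left.\<close>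

lemma num_blocks_halving:
  assumes "chi \<ge> 2"
  shows "real (num_blocks chi N i) \<le> real N / 2 ^ i + 1"
proof (induction i)
  case (Suc i)
  let ?n = "num_blocks chi N i"
  have "real ?n / real chi \<le> real ?n / 2"
    using assms by (intro divide_left_mono) auto
  also have "\<dots> \<le> real ((?n + 1) div 2)"
    by linarith
  finally have "num_blocks chi N (Suc i) \<le> (?n + 1) div 2"
    by (simp add: nat_le_iff ceiling_le_iff)
  then have "2 * num_blocks chi N (Suc i) \<le> ?n + 1"
    by linarith
  then have "real (2 * num_blocks chi N (Suc i)) \<le> real (?n + 1)"
    by (simp only: of_nat_le_iff)
  then have "real (num_blocks chi N (Suc i)) \<le> (real ?n + 1) / 2"
    by (simp del: num_blocks.simps)
  also have "\<dots> \<le> ((real N / 2 ^ i + 1) + 1) / 2"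
    using Suc by (intro divide_right_mono add_right_mono) auto
  also have "\<dots> = real N / 2 ^ Suc i + 1"
    by (simp add: add_divide_distrib)
  finally show ?case .
qed simp

lemma num_blocks_height_le:
  assumes "chi \<ge> 2"
  shows "num_blocks chi N (height N) \<le> chi"
proof -
  have "real N \<le> 2 ^ height N"
    using le_two_power_height[of N] by (metis of_nat_le_iff of_nat_numeral of_nat_power)
  then have "real N / 2 ^ height N \<le> 1"
    by simp
  then have "real (num_blocks chi N (height N)) \<le> 2"
    using num_blocks_halving[OF assms, of N "height N"] by linarith
  then show ?thesis
    using assms by linarith
qed

lemma top_oram_le_height:
  assumes "chi \<ge> 2"
  shows "top_oram chi N \<le> height N"
  unfolding top_oram_def using num_blocks_height_le[OF assms] by (rule Least_le)

lemma num_blocks_top_oram: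
  assumes "chi \<ge> 2"
  shows "num_blocks chi N (top_oram chi N) \<le> chi"
  unfolding top_oram_def using num_blocks_height_le[OF assms, of N] by (rule LeastI)

lemma height_le_log:
  assumes "N \<ge> 2"
  shows "log 2 (real N) \<ge> 1" "real (height N) \<le> 2 * log 2 (real N)"
proof -
  show l: "log 2 (real N) \<ge> 1"
    using assms by simp
  have "real (height N) \<le> log 2 (real N) + 1"
    unfolding height_def using l by linarith
  then show "real (height N) \<le> 2 * log 2 (real N)"
    using l by linarith
qed

lemma transfer_bounds:
  assumes "chi \<ge> 1" "transfer_ok chi N Ts"
  shows "small_transferred chi N Ts \<le> top_oram chi N * (10 * Suc (height N))"
    and "regular_transferred Ts \<le> 10 * Suc (height N)"
proof -
  have le: "blocks_transferred (Ts j) \<le> 10 * Suc (height N)" if "j \<le> top_oram chi N" for j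
  proof -
    have "oram_height chi N j \<le> height N"
      unfolding oram_height_def by (rule height_mono[OF num_blocks_le[OF assms(1)]])
    then show ?thesis
      using assms(2) that by (simp add: transfer_ok_def bucket_size_def)
  qed
  have "small_transferred chi N Ts \<le> (\<Sum>i = 1..top_oram chi N. 10 * Suc (height N))"
    unfolding small_transferred_def by (intro sum_mono le) simp
  then show "small_transferred chi N Ts \<le> top_oram chi N * (10 * Suc (height N))"
    by simp
  show "regular_transferred Ts \<le> 10 * Suc (height N)"
    unfolding regular_transferred_def by (rule le) simp
qed

text \<open>A small block has \<open>O(log N)\<close> bits and a regular one at least order
  \<open>(log N)^2\<close>, so converting small into regular blocks gains a factor
  \<open>log N\<close>. The function \<open>g\<close> is 1 for the bandwidth and \<open>h\<close>
  for the storage.\<close>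

lemma in_regular_blocks_bigo:
  fixes m r B :: "nat \<Rightarrow> nat" and g :: "nat \<Rightarrow> real"
  assumes m: "(\<lambda>N. real (m N)) \<in> O(\<lambda>N. (log 2 (real N))\<^sup>2 * g N)"
    and r: "(\<lambda>N. real (r N)) \<in> O(\<lambda>N. log 2 (real N) * g N)"
    and B: "(\<lambda>N. real (B N)) \<in> \<Omega>(\<lambda>N. (log 2 (real N))\<^sup>2)"
  shows "(\<lambda>N. in_regular_blocks chi N (B N) (m N) (r N)) \<in> O(\<lambda>N. log 2 (real N) * g N)"
proof -
  obtain c1 where c1: "c1 > 0" "\<forall>\<^sub>F N in at_top. norm (real (m N)) \<le> c1 * norm ((log 2 (real N))\<^sup>2 * g N)"
    using landau_o.bigE[OF m] .
  obtain c2 where c2: "c2 > 0" "\<forall>\<^sub>F N in at_top. norm (real (r N)) \<le> c2 * norm (log 2 (real N) * g N)"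
    using landau_o.bigE[OF r] .
  obtain c3 where c3: "c3 > 0" "\<forall>\<^sub>F N in at_top. norm (real (B N)) \<ge> c3 * norm ((log 2 (real N))\<^sup>2)"
    using landau_omega.bigE[OF B] .
  show ?thesis
  proof (rule bigoI[where c = "c1 * (2 * real chi) / c3 + c2"])
    show "\<forall>\<^sub>F N in at_top. norm (in_regular_blocks chi N (B N) (m N) (r N))
        \<le> (c1 * (2 * real chi) / c3 + c2) * norm (log 2 (real N) * g N)"
      using c1(2) c2(2) c3(2) eventually_ge_at_top[of 2]
    proof eventually_elim
      case (elim N)
      define l where "l = log 2 (real N)"
      have l: "l \<ge> 1" "real (height N) \<le> 2 * l"
        using height_le_log[OF elim(4)] by (auto simp: l_def)
      have m': "real (m N) \<le> c1 * (l\<^sup>2 * \<bar>g N\<bar>)"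
        using elim(1) by (simp add: abs_mult l_def)
      have r': "real (r N) \<le> c2 * (l * \<bar>g N\<bar>)"
        using elim(2) l by (simp add: abs_mult l_def)
      have B': "c3 * l\<^sup>2 \<le> real (B N)" "c3 * l\<^sup>2 > 0"
        using elim(3) c3(1) l by (simp_all add: l_def)
      have "in_regular_blocks chi N (B N) (m N) (r N) = real (m N) * (real chi * real (height N)) / real (B N) + real (r N)"
        using B' by (simp add: in_regular_blocks_def small_block_bits_def height_def add_divide_distrib)
      also have "real (m N) * (real chi * real (height N)) / real (B N)
          \<le> (c1 * (l\<^sup>2 * \<bar>g N\<bar>)) * (real chi * (2 * l)) / (c3 * l\<^sup>2)"
        using m' l B' c1 by (intro frac_le mult_mono) auto
      also have "\<dots> = c1 * (2 * real chi) / c3 * (l * \<bar>g N\<bar>)"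
        using l c3(1) by (simp add: field_simps)
      finally have "in_regular_blocks chi N (B N) (m N) (r N) \<le> (c1 * (2 * real chi) / c3 + c2) * (l * \<bar>g N\<bar>)"
        using r' by (simp add: distrib_right)
      moreover have "in_regular_blocks chi N (B N) (m N) (r N) \<ge> 0"
        by (simp add: in_regular_blocks_def)
      ultimately show ?case
        using l by (simp add: abs_mult l_def)
    qed
  qed
qed

text \<open>As \<open>9/25 \<le> 1/2\<close>, the base 3/5 is at most \<open>2 powr (- 1/2)\<close>,
  which accounts for the halved exponent.\<close>

lemma three_fifths_powr_log:
  assumes "N \<ge> 1" "t \<ge> 0"
  shows "(3/5) powr (log 2 (real N) * t) \<le> real N powr (- t / 2)"
proof -
  have "(3/5 :: real) \<le> 2 powr (- 1/2)"
  proof (rule power2_le_imp_le)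
    have "(2 powr (- 1/2))\<^sup>2 = (2 :: real) powr (- 1)"
      by (simp add: powr_power)
    also have "\<dots> = 1/2"
      by (simp add: powr_minus)
    finally show "(3/5 :: real)\<^sup>2 \<le> (2 powr (- 1/2))\<^sup>2"
      by (simp add: power2_eq_square)
  qed simp
  moreover have "log 2 (real N) * t \<ge> 0"
    using assms by simp
  ultimately have "(3/5 :: real) powr (log 2 (real N) * t) \<le> (2 powr (- 1/2)) powr (log 2 (real N) * t)"
    by (intro powr_mono2) auto
  also have "\<dots> = (2 powr log 2 (real N)) powr (- t / 2)"
    by (simp add: powr_powr)
  also have "2 powr log 2 (real N) = real N"
    using assms by simp
  finally show ?thesis .
qed

lemma superpoly_small_failure:
  fixes pick :: "nat \<Rightarrow> 'v policy" and ops :: "nat \<Rightarrow> 'v operation list" and h :: "nat \<Rightarrow> real"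
  assumes chi: "chi \<ge> 2" and h: "filterlim h at_top at_top"
    and cap: "\<And>N i. cap N i = nat \<lceil>log 2 (real N) * h N\<rceil>"
    and pick: "\<And>N. valid_policy (pick N)"
    and ops: "\<And>N opn. opn \<in> set (ops N) \<Longrightarrow> op_addr opn < N"
    and poly: "poly_bounded (\<lambda>N. length (ops N))"
  shows "superpoly_small (\<lambda>N. failure_prob chi N (cap N) (pick N) (d0 N) (ops N))"
proof -
  obtain k where "(\<lambda>N. real (length (ops N))) \<in> O(\<lambda>N. real N ^ k)"
    using poly unfolding poly_bounded_def by blast
  then obtain c where c: "c > 0" "\<forall>\<^sub>F N in at_top. norm (real (length (ops N))) \<le> c * norm (real N ^ k)"
    by (rule landau_o.bigE)
  \<comment> \<open>Of the \<open>k + 2\<close> powers of \<open>N\<close> given away,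
    \<open>k\<close> bound the number of operations, one the number of ORAMs, and one the constant
    \<open>18 * c\<close>, where \<open>18 = 3 * 6\<close>.\<close>
  define g where "g N = h N / 2 - real (k + 2)" for N
  have "\<forall>\<^sub>F N in at_top. h N \<ge> 1"
    using h by (rule filterlim_at_top[THEN iffD1, rule_format])
  with c(2) have "\<forall>\<^sub>F N in at_top. failure_prob chi N (cap N) (pick N) (d0 N) (ops N) \<le> real N powr (- g N)"
    using eventually_ge_at_top[of "2 + nat \<lceil>18 * c\<rceil>"]
  proof eventually_elim
    case (elim N)
    then have N: "N \<ge> 2" "real N \<ge> 18 * c"
      by linarith+
    define l where "l = log 2 (real N)"
    have l: "l \<ge> 1" "real (height N) \<le> 2 * l"
      using height_le_log[OF N(1)] by (auto simp: l_def)
    have "l \<le> real N"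
    proof -
      have "real N < 2 powr real N"
        using less_exp[of N] by (metis of_nat_less_iff of_nat_numeral of_nat_power powr_realpow zero_less_numeral)
      then show ?thesis
        using N(1) by (simp add: l_def log_le_iff)
    qed
    have X: "real (Suc (top_oram chi N)) \<le> 3 * real N"
      using top_oram_le_height[OF chi, of N] l \<open>l \<le> real N\<close> by linarith
    have len: "real (length (ops N)) \<le> c * real N ^ k"
      using elim(1) by simp
    have "(3/5 :: real) ^ cap N 0 = (3/5) powr real (cap N 0)"
      by (simp add: powr_realpow)
    also have "\<dots> \<le> (3/5) powr (l * h N)"
      unfolding cap l_def by (intro powr_mono') linarith+
    also have "\<dots> \<le> real N powr (- h N / 2)"
      unfolding l_def using N(1) elim(2) by (intro three_fifths_powr_log) auto
    finally have pow: "(3/5 :: real) ^ cap N 0 \<le> real N powr (- h N / 2)" .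
    have "failure_prob chi N (cap N) (pick N) (d0 N) (ops N)
        \<le> (\<Sum>i\<le>top_oram chi N. real (length (ops N)) * (6 * (3/5) ^ cap N i))"
      using chi by (intro failure_prob_bound pick ops) auto
    also have "\<dots> = real (Suc (top_oram chi N)) * (real (length (ops N)) * (6 * (3/5) ^ cap N 0))"
      by (simp add: cap)
    also have "\<dots> \<le> 3 * real N * (c * real N ^ k * (6 * real N powr (- h N / 2)))"
      using X len pow c(1) by (intro mult_mono) auto
    also have "\<dots> = 18 * c * (real N ^ (k + 1) * real N powr (- h N / 2))"
      by simp
    also have "\<dots> \<le> real N * (real N ^ (k + 1) * real N powr (- h N / 2))"
      using N by (intro mult_right_mono) auto
    also have "\<dots> = real N powr real (k + 2) * real N powr (- h N / 2)"
    proof -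
      have "real N powr real (k + 2) = real N ^ (k + 2)"
        using N by (intro powr_realpow) simp
      then show ?thesis
        by (simp only:) simp
    qed
    also have "\<dots> = real N powr (- g N)"
      by (simp add: powr_add[symmetric] g_def)
    finally show ?case .
  qed
  moreover have "filterlim g at_top at_top"
    unfolding filterlim_at_top
  proof
    fix Z
    have "\<forall>\<^sub>F N in at_top. h N \<ge> 2 * (Z + real (k + 2))"
      using h by (rule filterlim_at_top[THEN iffD1, rule_format])
    then show "\<forall>\<^sub>F N in at_top. Z \<le> g N"
      by eventually_elim (simp add: g_def)
  qed
  ultimately show ?thesis
    unfolding superpoly_small_def by blast
qed

lemma storage_bigo:
  fixes h :: "nat \<Rightarrow> real"
  assumes chi: "chi \<ge> 2" and h: "filterlim h at_top at_top"
    and cap: "\<And>N i. cap N i = nat \<lceil>log 2 (real N) * h N\<rceil>"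
  shows "(\<lambda>N. real (small_storage chi N (cap N))) \<in> O(\<lambda>N. (log 2 (real N))\<^sup>2 * h N)"
    and "(\<lambda>N. real (regular_storage (cap N))) \<in> O(\<lambda>N. log 2 (real N) * h N)"
proof -
  have h1: "\<forall>\<^sub>F N in at_top. h N \<ge> 1"
    using h by (rule filterlim_at_top[THEN iffD1, rule_format])
  have capb: "real (cap N i) \<le> 2 * (log 2 (real N) * h N)" if "N \<ge> 2" "h N \<ge> 1" for N i
  proof -
    have "1 * 1 \<le> log 2 (real N) * h N"
      using height_le_log(1)[OF that(1)] that(2) by (intro mult_mono) auto
    then show ?thesis
      unfolding cap by linarith
  qed
  show "(\<lambda>N. real (regular_storage (cap N))) \<in> O(\<lambda>N. log 2 (real N) * h N)"
  proof (rule bigoI[where c = 2])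
    show "\<forall>\<^sub>F N in at_top. norm (real (regular_storage (cap N))) \<le> 2 * norm (log 2 (real N) * h N)"
      using h1 eventually_ge_at_top[of 2]
    proof eventually_elim
      case (elim N)
      then show ?case
        using capb[of N 0] by (simp add: regular_storage_def)
    qed
  qed
  show "(\<lambda>N. real (small_storage chi N (cap N))) \<in> O(\<lambda>N. (log 2 (real N))\<^sup>2 * h N)"
  \<comment> \<open>The 5 is \<open>4 + 1\<close>: at most \<open>2 * l\<close> stashes of capacity
    at most \<open>2 * (l * h N)\<close>, and the client's position map, whose at most
    \<open>chi\<close> labels fit into one small block.\<close>
  proof (rule bigoI[where c = 5])
    show "\<forall>\<^sub>F N in at_top. norm (real (small_storage chi N (cap N))) \<le> 5 * norm ((log 2 (real N))\<^sup>2 * h N)"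
      using h1 eventually_ge_at_top[of 2]
    proof eventually_elim
      case (elim N)
      define l where "l = log 2 (real N)"
      have l: "l \<ge> 1" "real (height N) \<le> 2 * l"
        using height_le_log[OF elim(2)] by (auto simp: l_def)
      have lh: "l * h N \<ge> 1"
        using mult_mono[of 1 l 1 "h N"] l elim by simp
      then have l2h: "l\<^sup>2 * h N \<ge> 1"
        using mult_mono[of 1 l 1 "l * h N"] l by (simp add: power2_eq_square mult.assoc)
      have "real (num_blocks chi N (top_oram chi N)) / real chi \<le> 1"
        using num_blocks_top_oram[OF chi, of N] chi by simp
      then have "nat \<lceil>real (num_blocks chi N (top_oram chi N)) / real chi\<rceil> \<le> 1"
        by (simp add: nat_le_iff ceiling_le_iff)
      then have top: "real (nat \<lceil>real (num_blocks chi N (top_oram chi N)) / real chi\<rceil>) \<le> 1"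
        by simp
      have "real (\<Sum>i = 1..top_oram chi N. cap N i) = real (top_oram chi N) * real (cap N 0)"
        by (simp add: cap)
      also have "\<dots> \<le> (2 * l) * (2 * (l * h N))"
        using capb[OF elim(2,1), of 0] top_oram_le_height[OF chi, of N] l lh
        by (intro mult_mono) (auto simp: l_def)
      also have "\<dots> = 4 * (l\<^sup>2 * h N)"
        by (simp add: power2_eq_square)
      finally have "real (small_storage chi N (cap N)) \<le> 4 * (l\<^sup>2 * h N) + 1"
        using top unfolding small_storage_def of_nat_add by linarith
      then show ?case
        using l2h by (simp add: l_def)
    qed
  qed
qed

theorem mainTheorem2:
  fixes chi :: nat and B :: "nat \<Rightarrow> nat"
  assumes "chi \<ge> 2"
    and "(\<lambda>N. real (B N)) \<in> \<Omega>(\<lambda>N. (log 2 (real N))\<^sup>2)"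
  shows
    "(\<exists>m r :: nat \<Rightarrow> nat.
        (\<lambda>N. real (m N)) \<in> O(\<lambda>N. (log 2 (real N))\<^sup>2) \<and>
        (\<lambda>N. real (r N)) \<in> O(\<lambda>N. log 2 (real N)) \<and>
        (\<lambda>N. in_regular_blocks chi N (B N) (m N) (r N)) \<in> O(\<lambda>N. log 2 (real N)) \<and>
        (\<forall>N (pick :: 'v policy) d0 ops.
           N \<ge> 1 \<and> valid_policy pick \<and> (\<forall>opn\<in>set ops. op_addr opn < N) \<longrightarrow>
           (\<forall>E\<in>set_pmf (run chi N pick d0 ops). \<forall>(s, Ts)\<in>set E.
              small_transferred chi N Ts \<le> m N \<and> regular_transferred Ts \<le> r N))) \<and>
     (\<forall>h :: nat \<Rightarrow> real. filterlim h at_top at_top \<longrightarrow>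
        (\<exists>cap :: nat \<Rightarrow> nat \<Rightarrow> nat.
           (\<lambda>N. real (small_storage chi N (cap N))) \<in> O(\<lambda>N. (log 2 (real N))\<^sup>2 * h N) \<and>
           (\<lambda>N. real (regular_storage (cap N))) \<in> O(\<lambda>N. log 2 (real N) * h N) \<and>
           (\<lambda>N. in_regular_blocks chi N (B N) (small_storage chi N (cap N)) (regular_storage (cap N)))
              \<in> O(\<lambda>N. log 2 (real N) * h N) \<and>
           (\<forall>(pick :: nat \<Rightarrow> 'v policy) (d0 :: nat \<Rightarrow> nat \<Rightarrow> 'v) (ops :: nat \<Rightarrow> 'v operation list).
              (\<forall>N. valid_policy (pick N)) \<and>
              (\<forall>N. \<forall>opn\<in>set (ops N). op_addr opn < N) \<and>
              poly_bounded (\<lambda>N. length (ops N)) \<longrightarrow>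
              superpoly_small (\<lambda>N. failure_prob chi N (cap N) (pick N) (d0 N) (ops N)))))"
proof (intro conjI allI impI)
  \<comment> \<open>A bucket of five blocks is read and written on each level, which makes ten;
    every position-map ORAM is charged the height of the data ORAM.\<close>
  define m where "m N = top_oram chi N * (10 * Suc (height N))" for N
  define r where "r N = 10 * Suc (height N)" for N
  have bound: "real (m N) \<le> 60 * (log 2 (real N))\<^sup>2" "real (r N) \<le> 30 * log 2 (real N)" if "N \<ge> 2" for N
  proof -
    note l = height_le_log[OF that]
    show r: "real (r N) \<le> 30 * log 2 (real N)"
      using l by (simp add: r_def)
    have "real (m N) = real (top_oram chi N) * real (r N)"
      by (simp add: m_def r_def)
    also have "\<dots> \<le> (2 * log 2 (real N)) * (30 * log 2 (real N))"
      using top_oram_le_height[OF assms(1), of N] l r by (intro mult_mono) auto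
    finally show "real (m N) \<le> 60 * (log 2 (real N))\<^sup>2"
      by (simp add: power2_eq_square)
  qed
  have m: "(\<lambda>N. real (m N)) \<in> O(\<lambda>N. (log 2 (real N))\<^sup>2)"
    by (rule bigoI[where c = 60], rule eventually_mono[OF eventually_ge_at_top[of 2]])
      (use bound in simp)
  have r: "(\<lambda>N. real (r N)) \<in> O(\<lambda>N. log 2 (real N))"
    by (rule bigoI[where c = 30], rule eventually_mono[OF eventually_ge_at_top[of 2]])
      (use bound height_le_log in force)
  have mr: "(\<lambda>N. in_regular_blocks chi N (B N) (m N) (r N)) \<in> O(\<lambda>N. log 2 (real N))"
    using in_regular_blocks_bigo[of m "\<lambda>_. 1" r B chi] m r assms(2) by simp
  have transfer: "small_transferred chi N Ts \<le> m N \<and> regular_transferred Ts \<le> r N"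
    if "valid_policy pick" "E \<in> set_pmf (run chi N pick d0 ops)" "(s, Ts) \<in> set E"
    for N and pick :: "'v policy" and d0 ops E s Ts
  proof -
    have "chi \<ge> 1"
      using assms(1) by simp
    then show ?thesis
      using transfer_bounds run_transfer_ok that unfolding m_def r_def by blast
  qed
  show "\<exists>m r :: nat \<Rightarrow> nat.
        (\<lambda>N. real (m N)) \<in> O(\<lambda>N. (log 2 (real N))\<^sup>2) \<and>
        (\<lambda>N. real (r N)) \<in> O(\<lambda>N. log 2 (real N)) \<and>
        (\<lambda>N. in_regular_blocks chi N (B N) (m N) (r N)) \<in> O(\<lambda>N. log 2 (real N)) \<and>
        (\<forall>N (pick :: 'v policy) d0 ops.
           N \<ge> 1 \<and> valid_policy pick \<and> (\<forall>opn\<in>set ops. op_addr opn < N) \<longrightarrow>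
           (\<forall>E\<in>set_pmf (run chi N pick d0 ops). \<forall>(s, Ts)\<in>set E.
              small_transferred chi N Ts \<le> m N \<and> regular_transferred Ts \<le> r N))"
    by (rule exI[of _ m], rule exI[of _ r]) (use m r mr transfer in blast)
next
  fix h :: "nat \<Rightarrow> real"
  assume h: "filterlim h at_top at_top"
  \<comment> \<open>One capacity for all stashes: the number of ORAMs then contributes a logarithmic
    factor to the storage of small blocks and at most a polynomial one to the failure
    probability.\<close>
  define cap :: "nat \<Rightarrow> nat \<Rightarrow> nat" where "cap N i = nat \<lceil>log 2 (real N) * h N\<rceil>" for N i
  note storage = storage_bigo[OF assms(1) h, of cap, OF cap_def]
  have regular: "(\<lambda>N. in_regular_blocks chi N (B N) (small_storage chi N (cap N)) (regular_storage (cap N)))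
      \<in> O(\<lambda>N. log 2 (real N) * h N)"
    by (rule in_regular_blocks_bigo[OF storage assms(2)])
  have failure: "superpoly_small (\<lambda>N. failure_prob chi N (cap N) (pick N) (d0 N) (ops N))"
    if "\<forall>N. valid_policy (pick N)" "\<forall>N. \<forall>opn\<in>set (ops N). op_addr opn < N"
      "poly_bounded (\<lambda>N. length (ops N))"
    for pick :: "nat \<Rightarrow> 'v policy" and d0 :: "nat \<Rightarrow> nat \<Rightarrow> 'v" and ops :: "nat \<Rightarrow> 'v operation list"
    by (rule superpoly_small_failure[OF assms(1) h cap_def]) (use that in auto)
  show "\<exists>cap :: nat \<Rightarrow> nat \<Rightarrow> nat.
           (\<lambda>N. real (small_storage chi N (cap N))) \<in> O(\<lambda>N. (log 2 (real N))\<^sup>2 * h N) \<and>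
           (\<lambda>N. real (regular_storage (cap N))) \<in> O(\<lambda>N. log 2 (real N) * h N) \<and>
           (\<lambda>N. in_regular_blocks chi N (B N) (small_storage chi N (cap N)) (regular_storage (cap N)))
              \<in> O(\<lambda>N. log 2 (real N) * h N) \<and>
           (\<forall>(pick :: nat \<Rightarrow> 'v policy) (d0 :: nat \<Rightarrow> nat \<Rightarrow> 'v) (ops :: nat \<Rightarrow> 'v operation list).
              (\<forall>N. valid_policy (pick N)) \<and>
              (\<forall>N. \<forall>opn\<in>set (ops N). op_addr opn < N) \<and>
              poly_bounded (\<lambda>N. length (ops N)) \<longrightarrow>
              superpoly_small (\<lambda>N. failure_prob chi N (cap N) (pick N) (d0 N) (ops N)))"
    by (rule exI[of _ cap]) (use storage regular failure in blast)
qed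

end
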